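(* Let $\Omega=\{(x,y)\in\mathbb{R}^2: x^2+y^2<1\}$ and let $\gamma\in L^2(\Omega)$ be real-valued. Let $K^{cc},K^{ss},K^{sc},K^{cs}$ be the matrices of coefficients of the linearized Dirichlet-to-Neumann map $\Lambda_1'$ associated with $\gamma$ in the trigonometric basis (see context). Then $\gamma$ can be reconstructed from these matrices by the following expression in polar coordinates (convergence in $L^2(\Omega)$): $$\gamma(r,\phi)=\frac12\sum_{n=0}^\infty L_n^0(r)\,p_{n,0}+\sum_{k=1}^\infty\sum_{n=0}^\infty L_n^k(r)\cos(k\phi)\,p_{n,k}+\sum_{k=1}^\infty\sum_{n=0}^\infty L_n^k(r)\sin(k\phi)\,q_{n,k},$$ where $$p_{n,k}=\sum_{l=0}^n 2(-1)^{n-l}(2n+k+1)\frac{\prod_{j=0}^{n-1}(1+k+l+j)}{l!\,(n-l)!}\cdot\frac{K^{cc}_{l+1,l+1+k}}{(l+1)(l+1+k)\pi},$$ $$q_{n,k}=\sum_{l=0}^n 2(-1)^{n-l}(2n+k+1)\frac{\prod_{j=0}^{n-1}(1+k+l+j)}{l!\,(n-l)!}\cdot\frac{K^{cs}_{l+1,l+1+k}}{(l+1)(l+1+k)\pi}.$$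
   Context: For boundary functions $f,g$ on the unit circle, $\langle\Lambda_1' f,g\rangle:=\int_\Omega\gamma\,\nabla u_f\cdot\nabla u_g\,dx$, where $u_f$ denotes the harmonic function in $\Omega$ with boundary values $f$. For $f=\cos(n\phi)$, resp. $f=\sin(n\phi)$, one has $u_f=r^n\cos(n\phi)$, resp. $u_f=r^n\sin(n\phi)$, in polar coordinates. For $i,j\in\mathbb{N}=\{1,2,\dots\}$: $K^{cc}_{i,j}=\langle\Lambda_1'\cos(i\phi),\cos(j\phi)\rangle$, $K^{ss}_{i,j}=\langle\Lambda_1'\sin(i\phi),\sin(j\phi)\rangle$, $K^{sc}_{i,j}=\langle\Lambda_1'\sin(i\phi),\cos(j\phi)\rangle$, $K^{cs}_{i,j}=\langle\Lambda_1'\cos(i\phi),\sin(j\phi)\rangle$. For integers $k\ge0$, $n\ge0$: $L_n^k(x):=\sum_{l=0}^n c^k_{l,n}x^{2l+k}$ with $c^k_{l,n}:=\dfrac{\prod_{j=0}^{n-1}(l+j+k+1)}{\prod_{j=0,\,j\ne l}^{n}(l-j)}$. Empty products equal $1$. *)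

theory Defs
  imports "HOL-Analysis.Analysis"
begin

definition unit_disc :: "(real \<times> real) set" where
  "unit_disc = {(x, y). x\<^sup>2 + y\<^sup>2 < 1}"

definition polar_radius :: "real \<times> real \<Rightarrow> real" where
  "polar_radius z = sqrt ((fst z)\<^sup>2 + (snd z)\<^sup>2)"

definition polar_angle :: "real \<times> real \<Rightarrow> real" where
  "polar_angle z = Arg (Complex (fst z) (snd z))"


section \<open>Real L2 functions\<close>

definition L2_fun :: "'a measure \<Rightarrow> ('a \<Rightarrow> real) \<Rightarrow> bool" where
  "L2_fun M f \<longleftrightarrow> f \<in> borel_measurable M \<and> integrable M (\<lambda>x. (f x)\<^sup>2)"

text \<open>
  Convergence of a series of functions in the mean square, in analogy with \<^const>\<open>sums\<close>. The
  membership conditions guarantee that the integrals below are never the default value of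
  a non-integrable function. The sum \<open>s\<close> is determined up to null sets.
\<close>

definition L2_sums :: "'a measure \<Rightarrow> (nat \<Rightarrow> 'a \<Rightarrow> real) \<Rightarrow> ('a \<Rightarrow> real) \<Rightarrow> bool" where
  "L2_sums M f s \<longleftrightarrow> (\<forall>n. L2_fun M (f n)) \<and> L2_fun M s \<and>
     (\<lambda>N. \<integral>x. ((\<Sum>n<N. f n x) - s x)\<^sup>2 \<partial>M) \<longlonglongrightarrow> 0"


section \<open>Harmonic functions\<close>

definition gradient :: "('a::euclidean_space \<Rightarrow> real) \<Rightarrow> 'a \<Rightarrow> 'a" where
  "gradient u x = (THE D. GDERIV u x :> D)"

definition laplacian :: "('a::euclidean_space \<Rightarrow> real) \<Rightarrow> 'a \<Rightarrow> real" where
  "laplacian u x = (\<Sum>b\<in>Basis. frechet_derivative (gradient u) (at x) b \<bullet> b)"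

text \<open>Meaningful for open sets \<open>S\<close> only.\<close>

definition C2_on :: "('a::euclidean_space \<Rightarrow> real) \<Rightarrow> 'a set \<Rightarrow> bool" where
  "C2_on u S \<longleftrightarrow>
     (\<forall>x\<in>S. u differentiable (at x) \<and> gradient u differentiable (at x)) \<and>
     (\<forall>b\<in>Basis. continuous_on S (\<lambda>x. frechet_derivative (gradient u) (at x) b))"

definition harmonic_on :: "('a::euclidean_space \<Rightarrow> real) \<Rightarrow> 'a set \<Rightarrow> bool" where
  "harmonic_on u S \<longleftrightarrow> C2_on u S \<and> (\<forall>x\<in>S. laplacian u x = 0)"

text \<open>
  Boundary functions are given as functions of the angle. The Dirichlet problem determines
  the solution on the closed disc, and hence its gradient in the open disc; the choice
  operator only affects values outside the closed disc.
\<close>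

definition dirichlet_solution :: "(real \<Rightarrow> real) \<Rightarrow> (real \<times> real \<Rightarrow> real) \<Rightarrow> bool" where
  "dirichlet_solution f u \<longleftrightarrow>
     continuous_on (closure unit_disc) u \<and> harmonic_on u unit_disc \<and>
     (\<forall>\<phi>. u (cos \<phi>, sin \<phi>) = f \<phi>)"

definition harmonic_extension :: "(real \<Rightarrow> real) \<Rightarrow> real \<times> real \<Rightarrow> real" where
  "harmonic_extension f = (SOME u. dirichlet_solution f u)"


section \<open>The linearized Dirichlet-to-Neumann map\<close>

definition lin_DN :: "(real \<times> real \<Rightarrow> real) \<Rightarrow> (real \<Rightarrow> real) \<Rightarrow> (real \<Rightarrow> real) \<Rightarrow> real" where
  "lin_DN \<gamma> f g =
     (\<integral>z. \<gamma> z * (gradient (harmonic_extension f) z \<bullet> gradient (harmonic_extension g) z)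
        \<partial>(lebesgue_on unit_disc))"

definition K_cc :: "(real \<times> real \<Rightarrow> real) \<Rightarrow> nat \<Rightarrow> nat \<Rightarrow> real" where
  "K_cc \<gamma> i j = lin_DN \<gamma> (\<lambda>\<phi>. cos (real i * \<phi>)) (\<lambda>\<phi>. cos (real j * \<phi>))"

definition K_ss :: "(real \<times> real \<Rightarrow> real) \<Rightarrow> nat \<Rightarrow> nat \<Rightarrow> real" where
  "K_ss \<gamma> i j = lin_DN \<gamma> (\<lambda>\<phi>. sin (real i * \<phi>)) (\<lambda>\<phi>. sin (real j * \<phi>))"

definition K_sc :: "(real \<times> real \<Rightarrow> real) \<Rightarrow> nat \<Rightarrow> nat \<Rightarrow> real" where
  "K_sc \<gamma> i j = lin_DN \<gamma> (\<lambda>\<phi>. sin (real i * \<phi>)) (\<lambda>\<phi>. cos (real j * \<phi>))"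

definition K_cs :: "(real \<times> real \<Rightarrow> real) \<Rightarrow> nat \<Rightarrow> nat \<Rightarrow> real" where
  "K_cs \<gamma> i j = lin_DN \<gamma> (\<lambda>\<phi>. cos (real i * \<phi>)) (\<lambda>\<phi>. sin (real j * \<phi>))"


section \<open>Radial polynomials and reconstruction coefficients\<close>

definition radial_coeff :: "nat \<Rightarrow> nat \<Rightarrow> nat \<Rightarrow> real" where
  "radial_coeff k l n =
     (\<Prod>j<n. real (l + j + k + 1)) / (\<Prod>j\<in>{0..n} - {l}. real l - real j)"

definition radial_poly :: "nat \<Rightarrow> nat \<Rightarrow> real \<Rightarrow> real" where
  "radial_poly k n x = (\<Sum>l=0..n. radial_coeff k l n * x ^ (2 * l + k))"

text \<open>
  The coefficients \<open>p\<^sub>n\<^sub>,\<^sub>k\<close> and \<open>q\<^sub>n\<^sub>,\<^sub>k\<close> are given by the same formula, applied to the matrices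
  \<^const>\<open>K_cc\<close> and \<^const>\<open>K_cs\<close>, respectively.
\<close>

definition recon_coeff :: "(nat \<Rightarrow> nat \<Rightarrow> real) \<Rightarrow> nat \<Rightarrow> nat \<Rightarrow> real" where
  "recon_coeff K n k =
     (\<Sum>l=0..n. 2 * (-1) ^ (n - l) * real (2 * n + k + 1) *
        ((\<Prod>j<n. real (1 + k + l + j)) / (fact l * fact (n - l))) *
        (K (l + 1) (l + 1 + k) / (real (l + 1) * real (l + 1 + k) * pi)))"

end

theory Submission
  imports Defs
begin

text \<open>
  The functions \<open>Z\<^sub>k\<^sub>,\<^sub>n(z) = L\<^sub>n\<^sup>k(r) exp(i k \<phi>)\<close> are Zernike polynomials: their real and
  imaginary parts form a complete orthogonal system in \<open>L\<^sup>2\<close> of the disc, with squared norm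
  \<open>\<pi> / (2 (2n + k + 1))\<close> for \<open>k \<ge> 1\<close> and twice that for the real part with \<open>k = 0\<close>. As the
  gradients of \<open>Re z\<^sup>i\<close>, \<open>Re z\<^sup>j\<close> and \<open>Im z\<^sup>j\<close> are given by complex derivatives, the matrix entries
  \<open>K\<^sub>l\<^sub>+\<^sub>1\<^sub>,\<^sub>l\<^sub>+\<^sub>1\<^sub>+\<^sub>k\<close> are moments of \<open>\<gamma>\<close> against \<open>|z|\<^sup>2\<^sup>l z\<^sup>k\<close>, and the reconstruction coefficients are the
  Fourier coefficients of \<open>\<gamma>\<close> in this system, up to the factor \<open>1/2\<close> for \<open>k = 0\<close>.

  Polar coordinates are avoided: orthogonality reduces to the moments of \<open>z\<^sup>a (cnj z)\<^sup>b\<close> over the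
  disc, for which integration by parts gives a recursion, and to a partial fraction expansion of
  the coefficients of \<open>L\<^sub>n\<^sup>k\<close>. Completeness follows from the Stone-Weierstrass theorem.
\<close>


section \<open>Orthogonal series in the space of square integrable functions\<close>

lemma L2_fun_mult_integrable:
  assumes "L2_fun M f" "L2_fun M g"
  shows "integrable M (\<lambda>x. f x * g x)"
proof (rule Bochner_Integration.integrable_bound)
  show "integrable M (\<lambda>x. (f x)\<^sup>2 + (g x)\<^sup>2)" "(\<lambda>x. f x * g x) \<in> borel_measurable M"
    using assms by (auto simp: L2_fun_def)
  have "norm (a * b) \<le> norm (a\<^sup>2 + b\<^sup>2)" for a b :: real
  proof -
    have "2 * (\<bar>a\<bar> * \<bar>b\<bar>) \<le> a\<^sup>2 + b\<^sup>2" "0 \<le> \<bar>a\<bar> * \<bar>b\<bar>"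
      using sum_squares_bound[of "\<bar>a\<bar>" "\<bar>b\<bar>"] by (simp_all add: mult.assoc)
    then have "\<bar>a\<bar> * \<bar>b\<bar> \<le> a\<^sup>2 + b\<^sup>2" by linarith
    then show ?thesis by (simp add: abs_mult)
  qed
  then show "AE x in M. norm (f x * g x) \<le> norm ((f x)\<^sup>2 + (g x)\<^sup>2)" by simp
qed

lemma L2_fun_add:
  assumes "L2_fun M f" "L2_fun M g"
  shows "L2_fun M (\<lambda>x. f x + g x)"
  using assms L2_fun_mult_integrable[OF assms]
  by (auto simp: L2_fun_def power2_sum mult.assoc)

lemma L2_fun_cmult:
  assumes "L2_fun M f"
  shows "L2_fun M (\<lambda>x. c * f x)"
  using assms by (auto simp: L2_fun_def power_mult_distrib)

lemma L2_fun_diff: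
  assumes "L2_fun M f" "L2_fun M g"
  shows "L2_fun M (\<lambda>x. f x - g x)"
  using L2_fun_add[OF assms(1) L2_fun_cmult[OF assms(2), of "-1"]] by simp

lemma L2_fun_zero: "L2_fun M (\<lambda>x. 0)"
  by (auto simp: L2_fun_def)

lemma L2_fun_sum:
  assumes "\<And>i. i \<in> I \<Longrightarrow> L2_fun M (f i)"
  shows "L2_fun M (\<lambda>x. \<Sum>i\<in>I. f i x)"
  using assms by (induction I rule: infinite_finite_induct) (auto simp: L2_fun_zero L2_fun_add)

text \<open>The integral of \<open>(f - t * g)\<^sup>2\<close> is a quadratic in \<open>t\<close>
  that is never negative; its minimum at \<open>t = B / C\<close> gives the bound.\<close>

lemma L2_Cauchy_Schwarz:
  assumes f: "L2_fun M f" and g: "L2_fun M g"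
  shows "(\<integral>x. f x * g x \<partial>M)\<^sup>2 \<le> (\<integral>x. (f x)\<^sup>2 \<partial>M) * (\<integral>x. (g x)\<^sup>2 \<partial>M)"
proof -
  define A B C where "A = (\<integral>x. (f x)\<^sup>2 \<partial>M)" and "B = (\<integral>x. f x * g x \<partial>M)" and "C = (\<integral>x. (g x)\<^sup>2 \<partial>M)"
  have i: "integrable M (\<lambda>x. (f x)\<^sup>2)" "integrable M (\<lambda>x. (g x)\<^sup>2)" "integrable M (\<lambda>x. f x * g x)"
    using assms L2_fun_mult_integrable[OF assms] by (auto simp: L2_fun_def)
  have q: "0 \<le> A - 2 * t * B + t\<^sup>2 * C" for t
  proof -
    have "0 \<le> (\<integral>x. (f x - t * g x)\<^sup>2 \<partial>M)" by simp
    also have "\<dots> = (\<integral>x. (f x)\<^sup>2 - 2 * t * (f x * g x) + t\<^sup>2 * (g x)\<^sup>2 \<partial>M)"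
      by (intro Bochner_Integration.integral_cong) (auto simp: power2_diff power_mult_distrib)
    also have "\<dots> = A - 2 * t * B + t\<^sup>2 * C"
      using i by (simp add: A_def B_def C_def)
    finally show ?thesis .
  qed
  have C: "C \<ge> 0" by (simp add: C_def)
  show ?thesis unfolding A_def[symmetric] B_def[symmetric] C_def[symmetric]
  proof (cases "C = 0")
    \<comment> \<open>In the degenerate case the quadratic is linear in \<open>t\<close>, and a
      nonzero slope would let it reach the value \<open>-1\<close>.\<close>
    case True
    have "B = 0"
    proof (rule ccontr)
      assume "B \<noteq> 0"
      then have "2 * ((A + 1) / (2 * B)) * B = A + 1" by simp
      then show False using q[of "(A + 1) / (2 * B)"] True by simp
    qed
    then show "B\<^sup>2 \<le> A * C" using True by simp
  next
    case False
    then have "C > 0" using C by simp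
    then show "B\<^sup>2 \<le> A * C"
      using q[of "B / C"] by (simp add: field_simps power2_eq_square)
  qed
qed

section \<open>Completeness of the space of square integrable functions\<close>

lemma summable_of_weighted_squares:
  fixes a :: "nat \<Rightarrow> real"
  assumes "summable (\<lambda>k. 2 ^ k * (a k)\<^sup>2)"
  shows "summable a"
proof (rule summable_comparison_test')
  show "summable (\<lambda>k. (1/2) ^ k + 2 ^ k * (a k)\<^sup>2)"
    using assms by (intro summable_add summable_geometric) auto
  show "norm (a k) \<le> (1/2) ^ k + 2 ^ k * (a k)\<^sup>2" for k
  proof -
    \<comment> \<open>This is the nonnegative square
      \<open>(1 - 2 ^ k * \<bar>a k\<bar>)\<^sup>2\<close> divided by \<open>2 ^ k\<close>.\<close>
    have "2 * \<bar>a k\<bar> \<le> (1/2)^k + 2^k * (a k)\<^sup>2"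
      using zero_le_power2[of "1 - 2^k * \<bar>a k\<bar>"]
      by (simp add: power2_diff power_mult_distrib field_simps power2_eq_square)
    then show ?thesis by simp
  qed
qed

text \<open>Riesz-Fischer: a subsequence with geometrically decaying increments converges almost
  everywhere, and Fatou's lemma shows that the whole sequence tends to that limit in mean
  square.\<close>

lemma L2_complete:
  fixes s :: "nat \<Rightarrow> 'a \<Rightarrow> real"
  assumes s: "\<And>n. L2_fun M (s n)"
    and cauchy: "\<And>e. e > 0 \<Longrightarrow> \<exists>N. \<forall>m\<ge>N. \<forall>n\<ge>N. (\<integral>x. (s m x - s n x)\<^sup>2 \<partial>M) \<le> e"
  shows "\<exists>t. L2_fun M t \<and> (\<lambda>n. \<integral>x. (s n x - t x)\<^sup>2 \<partial>M) \<longlonglongrightarrow> 0"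
proof -
  have [measurable]: "s n \<in> borel_measurable M" for n
    using s by (auto simp: L2_fun_def)
  have int: "integrable M (\<lambda>x. (s m x - s n x)\<^sup>2)" for m n
    using L2_fun_diff[OF s s] by (auto simp: L2_fun_def)
  obtain N where N: "\<And>k m n. m \<ge> N k \<Longrightarrow> n \<ge> N k \<Longrightarrow> (\<integral>x. (s m x - s n x)\<^sup>2 \<partial>M) \<le> (1/4) ^ k"
    using cauchy[of "(1/4)^k" for k] by (metis zero_less_divide_1_iff zero_less_numeral zero_less_power)
  \<comment> \<open>Partial sums make \<open>r\<close> monotone and at least \<open>N k\<close>; the
    summand \<open>k\<close> makes it unbounded, so that \<open>r k\<close> eventually exceeds any
    \<open>n0\<close>.\<close>
  define r where "r k = (\<Sum>i\<le>k. N i) + k" for k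
  have r: "N k \<le> r k" "k \<le> r k" "r k \<le> r (Suc k)" for k
    by (auto simp: r_def intro!: trans_le_add1 member_le_sum)
  have r': "N k \<le> r (Suc k)" for k using r(1,3)[of k] by linarith
  define g where "g k x = s (r (Suc k)) x - s (r k) x" for k x
  have [measurable]: "g k \<in> borel_measurable M" for k unfolding g_def by measurable
  have gi: "(\<integral>x. (g k x)\<^sup>2 \<partial>M) \<le> (1/4) ^ k" for k
    unfolding g_def by (intro N r r')
  \<comment> \<open>The weights \<open>2 ^ k\<close> make absolute convergence follow from square summability almost
    everywhere, also on spaces of infinite measure.\<close>
  have "(\<integral>\<^sup>+x. (\<Sum>k. ennreal (2 ^ k * (g k x)\<^sup>2)) \<partial>M) = (\<Sum>k. \<integral>\<^sup>+x. ennreal (2 ^ k * (g k x)\<^sup>2) \<partial>M)"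
    by (intro nn_integral_suminf) measurable
  also have "\<dots> \<le> (\<Sum>k. ennreal ((1/2) ^ k))"
  proof (intro suminf_le allI)
    fix k
    have "(\<integral>\<^sup>+x. ennreal (2 ^ k * (g k x)\<^sup>2) \<partial>M) = ennreal (\<integral>x. 2 ^ k * (g k x)\<^sup>2 \<partial>M)"
      using int by (intro nn_integral_eq_integral) (auto simp: g_def)
    also have "\<dots> \<le> ennreal (2 ^ k * (1/4) ^ k)"
      using gi by (intro ennreal_leI) simp
    also have "2 ^ k * (1/4::real) ^ k = (1/2) ^ k"
      by (simp flip: power_mult_distrib)
    finally show "(\<integral>\<^sup>+x. ennreal (2 ^ k * (g k x)\<^sup>2) \<partial>M) \<le> ennreal ((1/2) ^ k)" .
  qed auto
  also have "\<dots> = ennreal (\<Sum>k. (1/2) ^ k)"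
    by (intro suminf_ennreal2) (auto intro: summable_geometric)
  finally have "(\<integral>\<^sup>+x. (\<Sum>k. ennreal (2 ^ k * (g k x)\<^sup>2)) \<partial>M) \<noteq> \<infinity>"
    by (auto simp: top_unique)
  then have "AE x in M. (\<Sum>k. ennreal (2 ^ k * (g k x)\<^sup>2)) \<noteq> \<infinity>"
    by (intro nn_integral_noteq_infinite) auto
  then have lim: "AE x in M. (\<lambda>k. s (r k) x) \<longlonglongrightarrow> lim (\<lambda>k. s (r k) x)"
  proof eventually_elim
    case (elim x)
    then have "summable (\<lambda>k. 2 ^ k * (g k x)\<^sup>2)"
      by (intro summable_suminf_not_top) auto
    then have "summable (\<lambda>k. g k x)" by (rule summable_of_weighted_squares)
    then have "convergent (\<lambda>n. \<Sum>k<n. g k x)"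
      by (simp add: summable_iff_convergent)
    moreover have "(\<Sum>k<n. g k x) = s (r n) x - s (r 0) x" for n
      unfolding g_def by (rule sum_lessThan_telescope)
    ultimately have "convergent (\<lambda>n. s (r n) x)"
      using convergent_add[OF _ convergent_const, of "\<lambda>n. \<Sum>k<n. g k x" "s (r 0) x"] by simp
    then show ?case by (simp add: convergent_LIMSEQ_iff)
  qed
  \<comment> \<open>\<open>lim\<close> is total, so \<open>t\<close> is measurable everywhere; it is
    the true limit almost everywhere.\<close>
  define t where "t x = lim (\<lambda>k. s (r k) x)" for x
  have [measurable]: "t \<in> borel_measurable M" unfolding t_def by measurable
  \<comment> \<open>The Cauchy bound for \<open>s n - s (r k)\<close> survives the limit in
    \<open>k\<close>. With bound 1 this places \<open>t\<close> in the space, with bound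
    \<open>e / 2\<close> it gives convergence.\<close>
  have fatou: "integrable M (\<lambda>x. (s n x - t x)\<^sup>2) \<and> (\<integral>x. (s n x - t x)\<^sup>2 \<partial>M) \<le> e"
    if n: "\<forall>m\<ge>n0. \<forall>n\<ge>n0. (\<integral>x. (s m x - s n x)\<^sup>2 \<partial>M) \<le> e" "n \<ge> n0" for n n0 e
  proof -
    have e: "e \<ge> 0"
      using n by (meson Bochner_Integration.integral_nonneg order_trans zero_le_power2)
    have "(\<integral>\<^sup>+x. ennreal ((s n x - t x)\<^sup>2) \<partial>M) = (\<integral>\<^sup>+x. liminf (\<lambda>k. ennreal ((s n x - s (r k) x)\<^sup>2)) \<partial>M)"
    proof (rule nn_integral_cong_AE, use lim in eventually_elim)
      case (elim x)
      then have "(\<lambda>k. ennreal ((s n x - s (r k) x)\<^sup>2)) \<longlonglongrightarrow> ennreal ((s n x - t x)\<^sup>2)"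
        unfolding t_def by (intro tendsto_intros)
      then show ?case
        using lim_imp_Liminf[OF trivial_limit_sequentially] by metis
    qed
    also have "\<dots> \<le> liminf (\<lambda>k. \<integral>\<^sup>+x. ennreal ((s n x - s (r k) x)\<^sup>2) \<partial>M)"
      by (intro nn_integral_liminf) measurable
    also have "\<dots> \<le> liminf (\<lambda>k. ennreal e)"
    proof (rule Liminf_mono)
      show "\<forall>\<^sub>F k in sequentially. (\<integral>\<^sup>+x. ennreal ((s n x - s (r k) x)\<^sup>2) \<partial>M) \<le> ennreal e"
      proof (rule eventually_sequentiallyI[of n0])
        fix k assume "n0 \<le> k"
        then have "n0 \<le> r k" using r(2)[of k] by linarith
        have "(\<integral>\<^sup>+x. ennreal ((s n x - s (r k) x)\<^sup>2) \<partial>M) = ennreal (\<integral>x. (s n x - s (r k) x)\<^sup>2 \<partial>M)"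
          using int by (intro nn_integral_eq_integral) auto
        also have "\<dots> \<le> ennreal e" using n \<open>n0 \<le> r k\<close> by (intro ennreal_leI) auto
        finally show "(\<integral>\<^sup>+x. ennreal ((s n x - s (r k) x)\<^sup>2) \<partial>M) \<le> ennreal e" .
      qed
    qed
    finally have *: "(\<integral>\<^sup>+x. ennreal ((s n x - t x)\<^sup>2) \<partial>M) \<le> ennreal e" by (simp add: Liminf_const)
    then have i: "integrable M (\<lambda>x. (s n x - t x)\<^sup>2)"
      by (intro integrableI_bounded) (auto simp: less_top[symmetric] top_unique)
    have "ennreal (\<integral>x. (s n x - t x)\<^sup>2 \<partial>M) \<le> ennreal e"
      using * nn_integral_eq_integral[OF i] by simp
    then show ?thesis using i e by simp
  qed
  obtain n0 where n0: "\<forall>m\<ge>n0. \<forall>n\<ge>n0. (\<integral>x. (s m x - s n x)\<^sup>2 \<partial>M) \<le> 1" using cauchy[of 1] by auto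
  have "L2_fun M (\<lambda>x. s n0 x - t x)" using fatou[OF n0] by (auto simp: L2_fun_def)
  from L2_fun_diff[OF s[of n0] this] have "L2_fun M t" by simp
  moreover have "(\<lambda>n. \<integral>x. (s n x - t x)\<^sup>2 \<partial>M) \<longlonglongrightarrow> 0"
  proof (rule LIMSEQ_I)
    fix e :: real assume "e > 0"
    then obtain n0 where n0: "\<forall>m\<ge>n0. \<forall>n\<ge>n0. (\<integral>x. (s m x - s n x)\<^sup>2 \<partial>M) \<le> e / 2"
      using cauchy[of "e/2"] by auto
    show "\<exists>no. \<forall>n\<ge>no. norm ((\<integral>x. (s n x - t x)\<^sup>2 \<partial>M) - 0) < e"
      using fatou[OF n0] \<open>e > 0\<close> by (intro exI[of _ n0]) fastforce
  qed
  ultimately show ?thesis by blast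
qed

text \<open>Continuity of the inner product, by Cauchy-Schwarz applied to the remainder and
  \<open>h\<close>. All coefficients of a sum are read off this way.\<close>

lemma L2_sums_inner:
  assumes "L2_sums M f s" "L2_fun M h"
  shows "(\<lambda>n. \<integral>x. f n x * h x \<partial>M) sums (\<integral>x. s x * h x \<partial>M)"
proof -
  have f: "L2_fun M (f n)" and s: "L2_fun M s" for n using assms by (auto simp: L2_sums_def)
  let ?S = "\<lambda>N x. \<Sum>n<N. f n x"
  have S: "L2_fun M (?S N)" for N by (intro L2_fun_sum f)
  let ?d = "\<lambda>N. \<integral>x. (?S N x - s x) * h x \<partial>M"
  have "(\<lambda>N. (\<integral>x. (?S N x - s x)\<^sup>2 \<partial>M) * (\<integral>x. (h x)\<^sup>2 \<partial>M)) \<longlonglongrightarrow> 0 * (\<integral>x. (h x)\<^sup>2 \<partial>M)"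
    using assms by (intro tendsto_intros) (auto simp: L2_sums_def)
  then have "(\<lambda>N. (?d N)\<^sup>2) \<longlonglongrightarrow> 0"
    by (intro tendsto_sandwich[OF _ _ tendsto_const, of 0 "\<lambda>N. (?d N)\<^sup>2"])
       (auto intro!: always_eventually L2_Cauchy_Schwarz L2_fun_diff S s assms)
  then have "?d \<longlonglongrightarrow> 0"
    using tendsto_real_sqrt[of "\<lambda>N. (?d N)\<^sup>2" 0] by (simp add: tendsto_rabs_zero_iff)
  then have "(\<lambda>N. ?d N + (\<integral>x. s x * h x \<partial>M)) \<longlonglongrightarrow> 0 + (\<integral>x. s x * h x \<partial>M)"
    by (intro tendsto_intros)
  moreover have "?d N + (\<integral>x. s x * h x \<partial>M) = (\<Sum>n<N. \<integral>x. f n x * h x \<partial>M)" for N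
  proof -
    note i = L2_fun_mult_integrable[OF S assms(2)] L2_fun_mult_integrable[OF s assms(2)]
      L2_fun_mult_integrable[OF f assms(2)]
    have "?d N = (\<integral>x. ?S N x * h x \<partial>M) - (\<integral>x. s x * h x \<partial>M)"
      using i by (simp add: left_diff_distrib)
    moreover have "(\<integral>x. ?S N x * h x \<partial>M) = (\<Sum>n<N. \<integral>x. f n x * h x \<partial>M)"
      using i by (simp add: sum_distrib_right)
    ultimately show ?thesis by simp
  qed
  ultimately show ?thesis by (simp add: sums_def)
qed

section \<open>Orthogonal expansions, simple and iterated\<close>

lemma integral_square_orthogonal_sum:
  assumes f: "\<And>n. n \<in> I \<Longrightarrow> L2_fun M (f n)"
    and orth: "\<And>m n. m \<in> I \<Longrightarrow> n \<in> I \<Longrightarrow> m \<noteq> n \<Longrightarrow> (\<integral>x. f m x * f n x \<partial>M) = 0"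
    and "finite I"
  shows "(\<integral>x. (\<Sum>n\<in>I. f n x)\<^sup>2 \<partial>M) = (\<Sum>n\<in>I. \<integral>x. (f n x)\<^sup>2 \<partial>M)"
proof -
  have "(\<integral>x. (\<Sum>n\<in>I. f n x)\<^sup>2 \<partial>M) = (\<integral>x. (\<Sum>m\<in>I. \<Sum>n\<in>I. f m x * f n x) \<partial>M)"
    by (simp add: power2_eq_square sum_product)
  also have "\<dots> = (\<Sum>m\<in>I. \<Sum>n\<in>I. \<integral>x. f m x * f n x \<partial>M)"
    using f by (simp add: L2_fun_mult_integrable)
  also have "\<dots> = (\<Sum>m\<in>I. \<Sum>n\<in>I. if m = n then \<integral>x. (f m x)\<^sup>2 \<partial>M else 0)"
    using orth by (intro sum.cong) (auto simp: power2_eq_square)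
  finally show ?thesis using \<open>finite I\<close> by simp
qed

text \<open>Each \<open>f n\<close> is a projection of \<gamma>, so Bessel's inequality bounds the
  sum of the squared norms, and by Pythagoras the partial sums are Cauchy. The sum inherits the form
  of the assumption \<open>proj\<close>, so the lemma can be applied again to a series of such
  sums.\<close>

lemma orthogonal_L2_sums:
  fixes f :: "nat \<Rightarrow> 'a \<Rightarrow> real"
  assumes f: "\<And>n. L2_fun M (f n)" and \<gamma>: "L2_fun M \<gamma>"
    and orth: "\<And>m n. m \<noteq> n \<Longrightarrow> (\<integral>x. f m x * f n x \<partial>M) = 0"
    and proj: "\<And>n. (\<integral>x. f n x * \<gamma> x \<partial>M) = (\<integral>x. (f n x)\<^sup>2 \<partial>M)"
  shows "\<exists>s. L2_sums M f s \<and> (\<integral>x. s x * \<gamma> x \<partial>M) = (\<integral>x. (s x)\<^sup>2 \<partial>M)"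
proof -
  let ?S = "\<lambda>N x. \<Sum>n<N. f n x"
  have S: "L2_fun M (?S N)" for N by (intro L2_fun_sum f)
  have bessel: "(\<Sum>n<N. \<integral>x. (f n x)\<^sup>2 \<partial>M) \<le> (\<integral>x. (\<gamma> x)\<^sup>2 \<partial>M)" for N
  proof -
    have "0 \<le> (\<integral>x. (\<gamma> x - ?S N x)\<^sup>2 \<partial>M)" by simp
    also have "\<dots> = (\<integral>x. (\<gamma> x)\<^sup>2 - 2 * (\<Sum>n<N. f n x * \<gamma> x) + (?S N x)\<^sup>2 \<partial>M)"
      by (intro Bochner_Integration.integral_cong) (auto simp: power2_diff sum_distrib_left sum_distrib_right mult_ac)
    also have "\<dots> = (\<integral>x. (\<gamma> x)\<^sup>2 \<partial>M) - 2 * (\<Sum>n<N. \<integral>x. f n x * \<gamma> x \<partial>M) + (\<integral>x. (?S N x)\<^sup>2 \<partial>M)"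
    proof -
      have "integrable M (\<lambda>x. (\<gamma> x)\<^sup>2)" "integrable M (\<lambda>x. (?S N x)\<^sup>2)"
        using \<gamma> S[of N] by (auto simp: L2_fun_def)
      moreover have "integrable M (\<lambda>x. f n x * \<gamma> x)" for n
        by (rule L2_fun_mult_integrable[OF f \<gamma>])
      ultimately show ?thesis by simp
    qed
    finally show ?thesis
      using integral_square_orthogonal_sum[of "{..<N}" M f] f orth proj by simp
  qed
  have sq: "summable (\<lambda>n. \<integral>x. (f n x)\<^sup>2 \<partial>M)"
    using bessel by (intro summableI_nonneg_bounded) auto
  have "\<exists>t. L2_fun M t \<and> (\<lambda>n. \<integral>x. (?S n x - t x)\<^sup>2 \<partial>M) \<longlonglongrightarrow> 0"
  proof (rule L2_complete[OF S])
    fix e :: real assume "e > 0"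
    then obtain N where N: "\<And>m n. m \<ge> N \<Longrightarrow> norm (\<Sum>i\<in>{m..<n}. \<integral>x. (f i x)\<^sup>2 \<partial>M) < e"
      using sq unfolding summable_Cauchy by blast
    have le: "(\<integral>x. (?S n x - ?S m x)\<^sup>2 \<partial>M) \<le> e" if "m \<ge> N" "m \<le> n" for m n
    proof -
      have "(\<integral>x. (?S n x - ?S m x)\<^sup>2 \<partial>M) = (\<integral>x. (\<Sum>i\<in>{m..<n}. f i x)\<^sup>2 \<partial>M)"
        using that by (simp add: sum_diff_nat_ivl[of 0 m n, simplified atLeast0LessThan])
      also have "\<dots> = (\<Sum>i\<in>{m..<n}. \<integral>x. (f i x)\<^sup>2 \<partial>M)"
        using f orth by (intro integral_square_orthogonal_sum) auto
      finally show ?thesis using N[OF \<open>m \<ge> N\<close>, of n] by simp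
    qed
    have "(\<integral>x. (?S m x - ?S n x)\<^sup>2 \<partial>M) \<le> e" if "m \<ge> N" "n \<ge> N" for m n
    proof (cases "m \<le> n")
      case True
      then show ?thesis using le[OF that(1), of n] by (simp add: power2_commute)
    qed (use le[OF that(2), of m] in auto)
    then show "\<exists>N. \<forall>m\<ge>N. \<forall>n\<ge>N. (\<integral>x. (?S m x - ?S n x)\<^sup>2 \<partial>M) \<le> e" by blast
  qed
  then obtain s where s: "L2_fun M s" "L2_sums M f s" using f by (auto simp: L2_sums_def)
  have "(\<integral>x. f n x * s x \<partial>M) = (\<integral>x. (f n x)\<^sup>2 \<partial>M)" for n
  proof -
    have "(\<lambda>m. \<integral>x. f m x * f n x \<partial>M) sums (\<integral>x. s x * f n x \<partial>M)"
      by (rule L2_sums_inner[OF s(2) f])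
    moreover have "(\<lambda>m. \<integral>x. f m x * f n x \<partial>M) = (\<lambda>m. if m = n then \<integral>x. (f n x)\<^sup>2 \<partial>M else 0)"
      using orth by (auto simp: power2_eq_square)
    ultimately show ?thesis
      using sums_If_finite_set[of "{n}" "\<lambda>_. \<integral>x. (f n x)\<^sup>2 \<partial>M"] sums_unique2
      by (fastforce simp: mult.commute)
  qed
  \<comment> \<open>Both sides are the sum of the squared norms of the \<open>f n\<close>.\<close>
  then have "(\<integral>x. s x * \<gamma> x \<partial>M) = (\<integral>x. s x * s x \<partial>M)"
    using L2_sums_inner[OF s(2) \<gamma>] L2_sums_inner[OF s(2) s(1)] proj sums_unique2 by fastforce
  then show ?thesis using s(2) by (auto simp: power2_eq_square)
qed

text \<open>Besides convergence, this records that \<open>s\<close> is the orthogonal projection of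
  \<gamma> on the closed span of the \<open>e n\<close>: it has the same inner products with them,
  and whatever is orthogonal to all \<open>e n\<close> is orthogonal to \<open>s\<close>. Stating
  \<open>proj\<close> without division allows \<open>e n\<close> to vanish.\<close>

lemma orthogonal_expansion:
  fixes e :: "nat \<Rightarrow> 'a \<Rightarrow> real"
  assumes e: "\<And>n. L2_fun M (e n)" and \<gamma>: "L2_fun M \<gamma>"
    and orth: "\<And>m n. m \<noteq> n \<Longrightarrow> (\<integral>x. e m x * e n x \<partial>M) = 0"
    and proj: "\<And>n. a n * (\<integral>x. (e n x)\<^sup>2 \<partial>M) = (\<integral>x. e n x * \<gamma> x \<partial>M)"
  shows "\<exists>s. L2_sums M (\<lambda>n x. e n x * a n) s \<and>
    (\<integral>x. s x * \<gamma> x \<partial>M) = (\<integral>x. (s x)\<^sup>2 \<partial>M) \<and>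
    (\<forall>n. (\<integral>x. s x * e n x \<partial>M) = (\<integral>x. e n x * \<gamma> x \<partial>M)) \<and>
    (\<forall>h. L2_fun M h \<longrightarrow> (\<forall>n. (\<integral>x. e n x * h x \<partial>M) = 0) \<longrightarrow> (\<integral>x. s x * h x \<partial>M) = 0)"
proof -
  have inner: "(\<integral>x. e n x * a n * h x \<partial>M) = a n * (\<integral>x. e n x * h x \<partial>M)" for n h
    by (simp add: mult_ac)
  have "\<exists>s. L2_sums M (\<lambda>n x. e n x * a n) s \<and> (\<integral>x. s x * \<gamma> x \<partial>M) = (\<integral>x. (s x)\<^sup>2 \<partial>M)"
  proof (rule orthogonal_L2_sums)
    show "L2_fun M (\<lambda>x. e n x * a n)" for n using L2_fun_cmult[OF e, of "a n"] by (simp add: mult.commute)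
    show "(\<integral>x. (e n x * a n) * \<gamma> x \<partial>M) = (\<integral>x. (e n x * a n)\<^sup>2 \<partial>M)" for n
    proof -
      have "(\<integral>x. (e n x * a n)\<^sup>2 \<partial>M) = a n * (a n * (\<integral>x. (e n x)\<^sup>2 \<partial>M))"
        by (simp add: power_mult_distrib power2_eq_square[of "a n"])
      then show ?thesis using proj[of n] inner by simp
    qed
    show "(\<integral>x. (e m x * a m) * (e n x * a n) \<partial>M) = 0" if "m \<noteq> n" for m n
      using orth[OF that] inner[of m "\<lambda>x. e n x * a n"] by (simp flip: mult.assoc)
  qed fact
  then obtain s where s: "L2_sums M (\<lambda>n x. e n x * a n) s"
    "(\<integral>x. s x * \<gamma> x \<partial>M) = (\<integral>x. (s x)\<^sup>2 \<partial>M)" by blast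
  have "(\<integral>x. s x * e n x \<partial>M) = (\<integral>x. e n x * \<gamma> x \<partial>M)" for n
  proof -
    have "(\<lambda>m. \<integral>x. e m x * a m * e n x \<partial>M) sums (\<integral>x. s x * e n x \<partial>M)"
      by (rule L2_sums_inner[OF s(1) e])
    moreover have "(\<lambda>m. \<integral>x. e m x * a m * e n x \<partial>M) = (\<lambda>m. if m = n then \<integral>x. e n x * \<gamma> x \<partial>M else 0)"
      unfolding inner using orth proj by (auto simp: power2_eq_square)
    ultimately show ?thesis
      using sums_If_finite_set[of "{n}" "\<lambda>_. \<integral>x. e n x * \<gamma> x \<partial>M"] sums_unique2 by fastforce
  qed
  moreover have "(\<integral>x. s x * h x \<partial>M) = 0" if "L2_fun M h" "\<forall>n. (\<integral>x. e n x * h x \<partial>M) = 0" for h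
    using L2_sums_inner[OF s(1) that(1)] that(2) unfolding inner by (simp add: sums_0 sums_iff)
  ultimately show ?thesis using s by blast
qed

text \<open>The inner sums \<open>S k\<close> are projections of \<gamma> on mutually orthogonal
  subspaces, hence themselves satisfy the assumptions of \<open>orthogonal_L2_sums\<close>. The
  order of summation is that of the reconstruction formula.\<close>

lemma orthogonal_expansion_iterated:
  fixes e :: "nat \<Rightarrow> nat \<Rightarrow> 'a \<Rightarrow> real"
  assumes e: "\<And>k n. L2_fun M (e k n)" and \<gamma>: "L2_fun M \<gamma>"
    and orth: "\<And>j k m n. (j, m) \<noteq> (k, n) \<Longrightarrow> (\<integral>x. e j m x * e k n x \<partial>M) = 0"
    and proj: "\<And>k n. a k n * (\<integral>x. (e k n x)\<^sup>2 \<partial>M) = (\<integral>x. e k n x * \<gamma> x \<partial>M)"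
  shows "\<exists>S s. (\<forall>k. L2_sums M (\<lambda>n x. e k n x * a k n) (S k)) \<and> L2_sums M S s \<and>
    (\<forall>k n. (\<integral>x. s x * e k n x \<partial>M) = (\<integral>x. e k n x * \<gamma> x \<partial>M)) \<and>
    (\<forall>h. L2_fun M h \<longrightarrow> (\<forall>k n. (\<integral>x. e k n x * h x \<partial>M) = 0) \<longrightarrow> (\<integral>x. s x * h x \<partial>M) = 0)"
proof -
  define P where "P k s \<longleftrightarrow> L2_sums M (\<lambda>n x. e k n x * a k n) s \<and>
    (\<integral>x. s x * \<gamma> x \<partial>M) = (\<integral>x. (s x)\<^sup>2 \<partial>M) \<and>
    (\<forall>n. (\<integral>x. s x * e k n x \<partial>M) = (\<integral>x. e k n x * \<gamma> x \<partial>M)) \<and>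
    (\<forall>h. L2_fun M h \<longrightarrow> (\<forall>n. (\<integral>x. e k n x * h x \<partial>M) = 0) \<longrightarrow> (\<integral>x. s x * h x \<partial>M) = 0)" for k s
  have "\<exists>s. P k s" for k
    unfolding P_def
  proof (rule orthogonal_expansion[of M "e k" \<gamma> "a k"])
    show "(\<integral>x. e k m x * e k n x \<partial>M) = 0" if "m \<noteq> n" for m n using that by (intro orth) simp
  qed (fact e \<gamma> proj)+
  then obtain S where P: "\<And>k. P k (S k)" by metis
  then have S: "L2_sums M (\<lambda>n x. e k n x * a k n) (S k)"
    "(\<integral>x. S k x * \<gamma> x \<partial>M) = (\<integral>x. (S k x)\<^sup>2 \<partial>M)"
    "(\<integral>x. S k x * e k n x \<partial>M) = (\<integral>x. e k n x * \<gamma> x \<partial>M)"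
    "L2_fun M h \<Longrightarrow> \<forall>n. (\<integral>x. e k n x * h x \<partial>M) = 0 \<Longrightarrow> (\<integral>x. S k x * h x \<partial>M) = 0" for k n h
    unfolding P_def by blast+
  have SL: "L2_fun M (S k)" for k using S(1) by (auto simp: L2_sums_def)
  have Se: "(\<integral>x. S j x * e k n x \<partial>M) = 0" if "j \<noteq> k" for j k n
    using that by (intro S(4) e) (auto intro: orth)
  \<comment> \<open>The span property \<open>S(4)\<close> is used once in \<open>Se\<close> and once
    here, for one factor each.\<close>
  have SS: "(\<integral>x. S j x * S k x \<partial>M) = 0" if "j \<noteq> k" for j k
    using that by (intro S(4) SL) (auto simp: Se mult.commute[of "e _ _ _"])
  obtain s where s: "L2_sums M S s"
    using orthogonal_L2_sums[where f = S, OF SL \<gamma> SS S(2)] by blast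
  have "(\<integral>x. s x * e k n x \<partial>M) = (\<integral>x. e k n x * \<gamma> x \<partial>M)" for k n
  proof -
    have "(\<lambda>j. \<integral>x. S j x * e k n x \<partial>M) sums (\<integral>x. s x * e k n x \<partial>M)"
      by (rule L2_sums_inner[OF s e])
    moreover have "(\<lambda>j. \<integral>x. S j x * e k n x \<partial>M) = (\<lambda>j. if j = k then \<integral>x. e k n x * \<gamma> x \<partial>M else 0)"
      using Se S(3) by auto
    ultimately show ?thesis
      using sums_If_finite_set[of "{k}" "\<lambda>_. \<integral>x. e k n x * \<gamma> x \<partial>M"] sums_unique2 by fastforce
  qed
  moreover have "(\<integral>x. s x * h x \<partial>M) = 0" if "L2_fun M h" "\<forall>k n. (\<integral>x. e k n x * h x \<partial>M) = 0" for h
    using L2_sums_inner[OF s that(1)] S(4)[OF that(1)] that(2) by (simp add: sums_0 sums_iff)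
  ultimately show ?thesis using S(1) s by blast
qed


section \<open>Complex moments of the disc\<close>

definition cpx :: "real \<times> real \<Rightarrow> complex" where
  "cpx z = Complex (fst z) (snd z)"

lemma bounded_linear_cpx: "bounded_linear cpx"
proof -
  have "cpx = (\<lambda>z. of_real (fst z) + \<i> * of_real (snd z))"
    by (auto simp: cpx_def complex_eq_iff)
  moreover have "bounded_linear \<dots>"
    by (intro bounded_linear_add bounded_linear_const_mult bounded_linear_compose[OF bounded_linear_of_real]
        bounded_linear_fst bounded_linear_snd)
  ultimately show ?thesis by simp
qed

lemmas continuous_on_cpx [continuous_intros] = bounded_linear.continuous_on[OF bounded_linear_cpx]

section \<open>Integration over the disc and integration by parts\<close>

lemma unit_disc_eq_ball: "unit_disc = ball 0 1"
proof -
  have "(x, y) \<in> unit_disc \<longleftrightarrow> (x, y) \<in> ball 0 1" for x y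
    by (simp add: unit_disc_def norm_Pair)
  then show ?thesis by auto
qed

lemma closure_unit_disc: "closure unit_disc = cball 0 1"
  by (simp add: unit_disc_eq_ball)

lemma open_unit_disc: "open unit_disc"
  by (simp add: unit_disc_eq_ball)

lemma unit_disc_measurable [measurable, simp]:
  "unit_disc \<in> sets borel" "unit_disc \<in> sets lborel" "unit_disc \<in> sets lebesgue"
  using open_unit_disc by (auto intro: lborelD)

abbreviation disc_measure :: "(real \<times> real) measure" where
  "disc_measure \<equiv> lebesgue_on unit_disc"

lemma continuous_on_set_integrable_disc:
  fixes f :: "real \<times> real \<Rightarrow> 'a::{banach, second_countable_topology}"
  assumes "continuous_on UNIV f"
  shows "integrable lborel (\<lambda>z. indicator unit_disc z *\<^sub>R f z)"
proof -
  have "set_integrable lborel (cball 0 1) f"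
    unfolding set_integrable_def using assms
    by (intro borel_integrable_compact) (auto intro: continuous_on_subset)
  then show ?thesis
    using set_integrable_subset[of lborel "cball 0 1" f unit_disc]
    by (auto simp: set_integrable_def unit_disc_eq_ball)
qed

text \<open>A continuous integrand is Borel, so completion does not change its integral; on the
  Borel side Fubini's theorem applies to the product of two lines.\<close>

lemma
  fixes f :: "real \<times> real \<Rightarrow> 'a::{banach, second_countable_topology}"
  assumes f: "continuous_on UNIV f"
  shows integrable_disc_continuous: "integrable disc_measure f"
    and integral_disc_continuous:
      "integral\<^sup>L disc_measure f = (\<integral>z. indicator unit_disc z *\<^sub>R f z \<partial>lborel)"
proof -
  have [measurable]: "f \<in> borel_measurable borel"
    using f by (rule borel_measurable_continuous_onI)
  have m: "(\<lambda>z. indicator unit_disc z *\<^sub>R f z) \<in> borel_measurable lborel" by measurable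
  show "integrable disc_measure f"
    using continuous_on_set_integrable_disc[OF f] m
    by (simp add: integrable_restrict_space integrable_completion)
  show "integral\<^sup>L disc_measure f = (\<integral>z. indicator unit_disc z *\<^sub>R f z \<partial>lborel)"
    using m by (simp add: integral_restrict_space integral_completion)
qed

lemma L2_fun_continuous:
  fixes f :: "real \<times> real \<Rightarrow> real"
  assumes "continuous_on UNIV f"
  shows "L2_fun disc_measure f"
  unfolding L2_fun_def
  using assms by (auto intro!: integrable_disc_continuous continuous_intros
      intro: borel_measurable_integrable)

text \<open>The fundamental theorem of calculus on the chord at coordinate \<open>c\<close>: both
  endpoints lie on the circle, where \<open>H\<close> vanishes. For \<open>c\<^sup>2 \<ge> 1\<close>
  the open chord is empty.\<close>

lemma integral_derivative_chord:
  fixes H H' :: "real \<Rightarrow> complex"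
  assumes H: "\<And>y. (H has_vector_derivative H' y) (at y)"
    and cont: "continuous_on UNIV H'"
    and bd: "\<And>y. c\<^sup>2 + y\<^sup>2 = 1 \<Longrightarrow> H y = 0"
  shows "(\<integral>y. (if c\<^sup>2 + y\<^sup>2 < 1 then H' y else 0) \<partial>lborel) = 0"
proof (cases "c\<^sup>2 < 1")
  case False
  then have "\<not> c\<^sup>2 + y\<^sup>2 < 1" for y using zero_le_power2[of y] by linarith
  then show ?thesis by simp
next
  case True
  define s where "s = sqrt (1 - c\<^sup>2)"
  have s: "s > 0" "s\<^sup>2 = 1 - c\<^sup>2" using True by (auto simp: s_def)
  have *: "c\<^sup>2 + y\<^sup>2 < 1 \<longleftrightarrow> - s < y \<and> y < s" for y
  proof -
    have "c\<^sup>2 + y\<^sup>2 < 1 \<longleftrightarrow> y\<^sup>2 < s\<^sup>2" using s by auto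
    also have "\<dots> \<longleftrightarrow> \<bar>y\<bar> < s"
      using s abs_le_square_iff[of s y] by (auto simp: not_le[symmetric])
    finally show ?thesis by auto
  qed
  have [measurable]: "H' \<in> borel_measurable borel"
    using cont by (rule borel_measurable_continuous_onI)
  \<comment> \<open>The open chord is replaced by the closed interval; they differ in two points
    only.\<close>
  have "(\<integral>y. (if c\<^sup>2 + y\<^sup>2 < 1 then H' y else 0) \<partial>lborel) = (\<integral>y. indicator {-s..s} y *\<^sub>R H' y \<partial>lborel)"
  proof (rule integral_cong_AE)
    have "AE y in lborel. y \<noteq> s" "AE y in lborel. y \<noteq> - s" by (rule AE_lborel_singleton)+
    then show "AE y in lborel. (if c\<^sup>2 + y\<^sup>2 < 1 then H' y else 0) = indicator {-s..s} y *\<^sub>R H' y"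
      by eventually_elim (auto simp: * indicator_def)
  qed measurable
  also have "\<dots> = H s - H (- s)"
    using s cont H by (intro integral_FTC_Icc) (auto intro: has_vector_derivative_at_within continuous_on_subset)
  also have "\<dots> = 0" using bd[of s] bd[of "-s"] s by simp
  finally show ?thesis .
qed

text \<open>By Fubini the integral is an integral over parallel chords, each of which contributes
  zero.\<close>

lemma
  fixes H H' :: "real \<times> real \<Rightarrow> complex"
  assumes cont: "continuous_on UNIV H'"
    and bd: "\<And>x y. x\<^sup>2 + y\<^sup>2 = 1 \<Longrightarrow> H (x, y) = 0"
  shows integral_disc_partial_fst:
      "(\<And>x y. ((\<lambda>x. H (x, y)) has_vector_derivative H' (x, y)) (at x)) \<Longrightarrow> integral\<^sup>L disc_measure H' = 0"
    and integral_disc_partial_snd: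
      "(\<And>x y. ((\<lambda>y. H (x, y)) has_vector_derivative H' (x, y)) (at y)) \<Longrightarrow> integral\<^sup>L disc_measure H' = 0"
proof -
  let ?f = "\<lambda>z. indicator unit_disc z *\<^sub>R H' z"
  have f: "?f (x, y) = (if x\<^sup>2 + y\<^sup>2 < 1 then H' (x, y) else 0)"
      "?f (x, y) = (if y\<^sup>2 + x\<^sup>2 < 1 then H' (x, y) else 0)" for x y
    by (auto simp: unit_disc_def add.commute)
  have int: "integrable (lborel \<Otimes>\<^sub>M lborel) ?f"
    unfolding lborel_prod by (rule continuous_on_set_integrable_disc[OF cont])
  show "integral\<^sup>L disc_measure H' = 0"
    if "\<And>x y. ((\<lambda>y. H (x, y)) has_vector_derivative H' (x, y)) (at y)"
  proof -
    have "integral\<^sup>L disc_measure H' = (\<integral>x. (\<integral>y. ?f (x, y) \<partial>lborel) \<partial>lborel)"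
      using lborel_pair.integral_fst'[OF int] integral_disc_continuous[OF cont] by (simp add: lborel_prod)
    moreover have "(\<integral>y. ?f (x, y) \<partial>lborel) = 0" for x
      unfolding f(1) using that bd cont
      by (intro integral_derivative_chord[where H = "\<lambda>y. H (x, y)"])
         (auto intro!: continuous_on_compose2[OF cont] continuous_intros)
    ultimately show ?thesis by simp
  qed
  show "integral\<^sup>L disc_measure H' = 0"
    if "\<And>x y. ((\<lambda>x. H (x, y)) has_vector_derivative H' (x, y)) (at x)"
  proof -
    have "integral\<^sup>L disc_measure H' = (\<integral>y. (\<integral>x. ?f (x, y) \<partial>lborel) \<partial>lborel)"
      using lborel_pair.integral_snd[of "\<lambda>x y. ?f (x, y)"] int integral_disc_continuous[OF cont]
      by (simp add: lborel_prod case_prod_beta')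
    moreover have "(\<integral>x. ?f (x, y) \<partial>lborel) = 0" for y
      unfolding f(2) using that bd cont
      by (intro integral_derivative_chord[where H = "\<lambda>x. H (x, y)"])
         (auto intro!: continuous_on_compose2[OF cont] continuous_intros simp: add.commute)
    ultimately show ?thesis by simp
  qed
qed

section \<open>Moments of the monomials in \<open>z\<close> and its conjugate\<close>

definition moment :: "nat \<Rightarrow> nat \<Rightarrow> complex" where
  "moment a b = (\<integral>z. cpx z ^ a * cnj (cpx z) ^ b \<partial>disc_measure)"

lemma has_vector_derivative_cpx_fst: "((\<lambda>x. cpx (x, y)) has_vector_derivative 1) (at x)"
proof -
  have "(\<lambda>x. cpx (x, y)) = (\<lambda>x. of_real x + \<i> * of_real y)" by (auto simp: cpx_def complex_eq_iff)
  then show ?thesis by (auto intro!: derivative_eq_intros)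
qed

lemma has_vector_derivative_cpx_snd: "((\<lambda>y. cpx (x, y)) has_vector_derivative \<i>) (at y)"
proof -
  have "(\<lambda>y. cpx (x, y)) = (\<lambda>y. of_real x + \<i> * of_real y)" by (auto simp: cpx_def complex_eq_iff)
  then show ?thesis by (auto intro!: derivative_eq_intros)
qed

text \<open>The chain rule along a curve with velocity \<open>d\<close>: the two brackets are the
  Wirtinger derivatives of \<open>(1 - z * cnj z) * (z ^ a * cnj z ^ b)\<close>. Truncation in
  \<open>a - 1\<close> and \<open>b - 1\<close> is harmless because of the factors \<open>a\<close>
  and \<open>b\<close>.\<close>

lemma has_vector_derivative_monomial:
  fixes g :: "real \<Rightarrow> complex"
  assumes "(g has_vector_derivative d) (at t)"
  shows "((\<lambda>t. (1 - g t * cnj (g t)) * (g t ^ a * cnj (g t) ^ b)) has_vector_derivative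
     d * (of_nat a * g t ^ (a - 1) * cnj (g t) ^ b - of_nat (a + 1) * g t ^ a * cnj (g t) ^ (b + 1)) +
     cnj d * (of_nat b * g t ^ a * cnj (g t) ^ (b - 1) - of_nat (b + 1) * g t ^ (a + 1) * cnj (g t) ^ b)) (at t)"
proof -
  have g: "(g has_derivative (\<lambda>h. h *\<^sub>R d)) (at t)"
    using assms by (simp add: has_vector_derivative_def)
  have c: "((\<lambda>t. cnj (g t)) has_derivative (\<lambda>h. h *\<^sub>R cnj d)) (at t)"
    using bounded_linear.has_derivative[OF bounded_linear_cnj g] by simp
  show ?thesis unfolding has_vector_derivative_def
    by (rule has_derivative_eq_rhs,
        rule has_derivative_mult[OF has_derivative_diff[OF has_derivative_const has_derivative_mult[OF g c]]
          has_derivative_mult[OF has_derivative_power[OF g] has_derivative_power[OF c]]])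
       (cases a; cases b; simp add: fun_eq_iff algebra_simps scaleR_conv_of_real)
qed


text \<open>
  The function \<open>(1 - z cnj z) z\<^sup>a (cnj z)\<^sup>b\<close> vanishes on the unit circle, so both its
  Wirtinger derivatives have integral zero over the disc.
\<close>

lemma
  shows moment_rec_left: "of_nat a * moment (a - 1) b = of_nat (a + 1) * moment a (b + 1)"
    and moment_rec_right: "of_nat b * moment a (b - 1) = of_nat (b + 1) * moment (a + 1) b"
proof -
  define A where "A z = of_nat a * cpx z ^ (a - 1) * cnj (cpx z) ^ b - of_nat (a + 1) * cpx z ^ a * cnj (cpx z) ^ (b + 1)" for z
  define B where "B z = of_nat b * cpx z ^ a * cnj (cpx z) ^ (b - 1) - of_nat (b + 1) * cpx z ^ (a + 1) * cnj (cpx z) ^ b" for z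
  define H where "H z = (1 - cpx z * cnj (cpx z)) * (cpx z ^ a * cnj (cpx z) ^ b)" for z
  have cont: "continuous_on UNIV A" "continuous_on UNIV B"
    unfolding A_def B_def by (intro continuous_intros)+
  have bd: "H (x, y) = 0" if "x\<^sup>2 + y\<^sup>2 = 1" for x y
  proof -
    have "cpx (x, y) * cnj (cpx (x, y)) = 1"
      using that by (simp add: cpx_def complex_eq_iff power2_eq_square)
    then show ?thesis by (simp add: H_def)
  qed
  have AB: "integrable disc_measure A" "integrable disc_measure B"
    using cont by (auto intro: integrable_disc_continuous)
  have "integral\<^sup>L disc_measure (\<lambda>z. 1 * A z + cnj 1 * B z) = 0"
  proof (rule integral_disc_partial_fst[where H = H])
    show "((\<lambda>x. H (x, y)) has_vector_derivative 1 * A (x, y) + cnj 1 * B (x, y)) (at x)" for x y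
      unfolding A_def B_def H_def
      by (rule has_vector_derivative_monomial[OF has_vector_derivative_cpx_fst])
  qed (use bd cont in \<open>auto intro!: continuous_intros\<close>)
  then have 1: "integral\<^sup>L disc_measure A + integral\<^sup>L disc_measure B = 0" using AB by simp
  have "integral\<^sup>L disc_measure (\<lambda>z. \<i> * A z + cnj \<i> * B z) = 0"
  proof (rule integral_disc_partial_snd[where H = H])
    show "((\<lambda>y. H (x, y)) has_vector_derivative \<i> * A (x, y) + cnj \<i> * B (x, y)) (at y)" for x y
      unfolding A_def B_def H_def
      by (rule has_vector_derivative_monomial[OF has_vector_derivative_cpx_snd])
  qed (use bd cont in \<open>auto intro!: continuous_intros\<close>)
  \<comment> \<open>The derivative along the first axis is \<open>A + B\<close>, along the second
    \<open>\<i> * (A - B)\<close>; hence both integrals vanish separately.\<close>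
  then have "\<i> * (integral\<^sup>L disc_measure A - integral\<^sup>L disc_measure B) = 0"
    using AB by (simp add: algebra_simps)
  with 1 have 0: "integral\<^sup>L disc_measure A = 0" "integral\<^sup>L disc_measure B = 0" by auto
  have int: "integrable disc_measure (\<lambda>z. cpx z ^ i * cnj (cpx z) ^ j)" for i j
    by (intro integrable_disc_continuous continuous_intros)
  have "integral\<^sup>L disc_measure A = of_nat a * moment (a - 1) b - of_nat (a + 1) * moment a (b + 1)"
    using int unfolding A_def moment_def by (simp only: mult.assoc Bochner_Integration.integral_diff
        Bochner_Integration.integrable_mult_right Bochner_Integration.integral_mult_right_zero)
  then show "of_nat a * moment (a - 1) b = of_nat (a + 1) * moment a (b + 1)" using 0 by simp
  have "integral\<^sup>L disc_measure B = of_nat b * moment a (b - 1) - of_nat (b + 1) * moment (a + 1) b"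
    using int unfolding B_def moment_def by (simp only: mult.assoc Bochner_Integration.integral_diff
        Bochner_Integration.integrable_mult_right Bochner_Integration.integral_mult_right_zero)
  then show "of_nat b * moment a (b - 1) = of_nat (b + 1) * moment (a + 1) b" using 0 by simp
qed

lemma measure_disc: "measure disc_measure unit_disc = pi"
proof -
  have "measure disc_measure unit_disc = measure lebesgue unit_disc"
    by (simp add: measure_restrict_space)
  also have "\<dots> = pi"
    by (simp add: unit_disc_eq_ball content_ball measure_completion unit_ball_vol_2)
  finally show ?thesis .
qed

text \<open>The recursions lower both exponents together. Off the diagonal this ends with a single
  zero exponent, where the factor \<open>of_nat 0\<close> kills the moment; on the diagonal it ends
  with the area of the disc.\<close>

lemma moment_eq: "moment a b = (if a = b then of_real (pi / (real a + 1)) else 0)"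
proof (induction a arbitrary: b)
  case 0
  show ?case
  proof (cases b)
    case 0
    then show ?thesis by (simp add: moment_def measure_disc scaleR_conv_of_real)
  next
    case (Suc b')
    then show ?thesis using moment_rec_left[of 0 b'] by simp
  qed
next
  case (Suc a)
  show ?case
  proof (cases b)
    case 0
    then show ?thesis using moment_rec_right[of 0 a] by simp
  next
    case (Suc b')
    have "of_nat (a + 2) * moment (Suc a) b = of_nat (a + 1) * moment a b'"
      using moment_rec_left[of "Suc a" b'] Suc by (simp add: add_ac)
    then have "moment (Suc a) b = of_nat (a + 1) * moment a b' / of_nat (a + 2)"
      by (simp add: field_simps del: of_nat_add of_nat_Suc)
    also have "\<dots> = (if a = b' then of_real (real (a + 1) * (pi / (real a + 1)) / real (a + 2)) else 0)"
      by (simp add: Suc.IH)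
    also have "real (a + 1) * (pi / (real a + 1)) = pi"
      by (simp add: add_nonneg_eq_0_iff add.commute)
    also have "real (a + 2) = real (Suc a) + 1" by simp
    finally show ?thesis using Suc by simp
  qed
qed


section \<open>Gram matrix of the radial polynomials\<close>

text \<open>Both sides are polynomials of degree at most \<open>n\<close> that agree at the
  \<open>n + 1\<close> nodes.\<close>

lemma lagrange_interpolation:
  fixes P :: "real poly"
  assumes "degree P \<le> n"
  shows "poly P x = (\<Sum>l=0..n. poly P (real l) * (\<Prod>j\<in>{0..n} - {l}. x - real j) /
    (\<Prod>j\<in>{0..n} - {l}. real l - real j))"
proof -
  define L where "L l = (\<Prod>j\<in>{0..n} - {l}. [:- real j, 1:])" for l
  define Q where "Q = (\<Sum>l=0..n. smult (poly P (real l) / (\<Prod>j\<in>{0..n} - {l}. real l - real j)) (L l))"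
  have L: "poly (L l) x = (\<Prod>j\<in>{0..n} - {l}. x - real j)" for l x
    by (simp add: L_def poly_prod)
  have "degree (L l) \<le> n" if "l \<le> n" for l
  proof -
    have "degree (L l) \<le> sum (degree \<circ> (\<lambda>j. [:- real j, 1:])) ({0..n} - {l})"
      unfolding L_def by (rule degree_prod_sum_le) simp
    also have "\<dots> = n" using that by simp
    finally show ?thesis .
  qed
  then have "degree Q \<le> n"
    unfolding Q_def by (intro degree_sum_le) (auto intro: order_trans[OF degree_smult_le])
  have Q: "poly Q x = (\<Sum>l=0..n. poly P (real l) * (\<Prod>j\<in>{0..n} - {l}. x - real j) /
    (\<Prod>j\<in>{0..n} - {l}. real l - real j))" for x
    by (simp add: Q_def poly_sum L)
  have "P = Q"
  proof (rule poly_eqI_degree[of "real ` {0..n}"])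
    fix x assume "x \<in> real ` {0..n}"
    then obtain i where i: "i \<le> n" "x = real i" by auto
    have "poly Q x = (\<Sum>l=0..n. if l = i then poly P (real i) else 0)"
      unfolding Q i(2)
    proof (rule sum.cong)
      fix l assume "l \<in> {0..n}"
      show "poly P (real l) * (\<Prod>j\<in>{0..n} - {l}. real i - real j) / (\<Prod>j\<in>{0..n} - {l}. real l - real j) =
        (if l = i then poly P (real i) else 0)"
      proof (cases "l = i")
        case False
        then have "(\<Prod>j\<in>{0..n} - {l}. real i - real j) = 0" using i by (intro prod_zero) auto
        then show ?thesis using False by simp
      qed simp
    qed simp
    then show "poly P x = poly Q x" using i by simp
  qed (use assms \<open>degree Q \<le> n\<close> in \<open>simp_all add: card_image\<close>)
  then have "poly P x = poly Q x" by (simp only:)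
  also note Q
  finally show ?thesis .
qed

text \<open>
  Interpolate the numerator of \<^const>\<open>radial_coeff\<close>, as a polynomial in \<open>l\<close>, at the nodes
  \<open>0, \<dots>, n\<close> and evaluate it at \<open>- s\<close>.
\<close>

lemma radial_coeff_partial_fractions:
  assumes "s > 0"
  shows "(\<Sum>l=0..n. radial_coeff k l n / (real l + s)) =
    (\<Prod>j<n. s - real (j + k + 1)) / (\<Prod>j=0..n. s + real j)"
proof -
  define P where "P = (\<Prod>j<n. [:real (j + k + 1), 1:])"
  have P: "poly P x = (\<Prod>j<n. x + real (j + k + 1))" for x
    by (simp add: P_def poly_prod add.commute)
  have "degree P \<le> sum (degree \<circ> (\<lambda>j. [:real (j + k + 1), 1:])) {..<n}"
    unfolding P_def by (rule degree_prod_sum_le) simp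
  then have "degree P \<le> n" by simp
  from lagrange_interpolation[OF this, of "- s"]
  have "poly P (- s) = (\<Sum>l=0..n. radial_coeff k l n * (\<Prod>j\<in>{0..n} - {l}. - s - real j))"
    by (simp add: P radial_coeff_def add_ac)
  also have "\<dots> = (\<Sum>l=0..n. radial_coeff k l n / (real l + s) * - (\<Prod>j=0..n. - s - real j))"
  proof (rule sum.cong)
    fix l assume l: "l \<in> {0..n}"
    define t where "t = real l + s"
    \<comment> \<open>Restoring the node factor missing from each Lagrange product turns the
      interpolation formula into partial fractions.\<close>
    have "(\<Prod>j=0..n. - s - real j) = (- s - real l) * (\<Prod>j\<in>{0..n} - {l}. - s - real j)"
      using l by (subst prod.remove[of _ l]) auto
    also have "- s - real l = - t" by (simp add: t_def)
    finally have e: "(\<Prod>j=0..n. - s - real j) = - t * (\<Prod>j\<in>{0..n} - {l}. - s - real j)" .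
    have "t > 0" using assms by (simp add: t_def add_nonneg_pos)
    then show "radial_coeff k l n * (\<Prod>j\<in>{0..n} - {l}. - s - real j) =
        radial_coeff k l n / (real l + s) * - (\<Prod>j=0..n. - s - real j)"
      unfolding t_def[symmetric] e by simp
  qed simp
  also have "\<dots> = (\<Sum>l=0..n. radial_coeff k l n / (real l + s)) * - (\<Prod>j=0..n. - s - real j)"
    by (simp only: sum_distrib_right)
  \<comment> \<open>There are \<open>n + 1\<close> signs here and \<open>n\<close> in
    \<open>poly P (- s)\<close>; with the outer minus both sides carry
    \<open>(-1) ^ n\<close>.\<close>
  also have "- (\<Prod>j=0..n. - s - real j) = (-1) ^ n * (\<Prod>j=0..n. s + real j)"
  proof -
    have "(\<Prod>j=0..n. - s - real j) = (\<Prod>j=0..n. - 1 * (s + real j))" by (intro prod.cong) auto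
    also have "\<dots> = (-1) ^ Suc n * (\<Prod>j=0..n. s + real j)"
      by (subst prod.distrib) simp
    finally show ?thesis by simp
  qed
  also have "poly P (- s) = (-1) ^ n * (\<Prod>j<n. s - real (j + k + 1))"
  proof -
    have "poly P (- s) = (\<Prod>j<n. - 1 * (s - real (j + k + 1)))"
      unfolding P by (intro prod.cong) auto
    also have "\<dots> = (-1) ^ n * (\<Prod>j<n. s - real (j + k + 1))"
      by (subst prod.distrib) simp
    finally show ?thesis .
  qed
  finally have "(\<Prod>j<n. s - real (j + k + 1)) =
      (\<Sum>l=0..n. radial_coeff k l n / (real l + s)) * (\<Prod>j=0..n. s + real j)"
    by (simp add: mult.left_commute)
  moreover have "(\<Prod>j=0..n. s + real j) > 0" using assms by (intro prod_pos) auto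
  then have "(\<Prod>j=0..n. s + real j) \<noteq> 0" by (rule less_imp_neq[symmetric])
  ultimately show ?thesis by (simp only: nonzero_mult_div_cancel_right not_False_eq_True)
qed

text \<open>At \<open>s = m + k + 1\<close> the numerator of the partial fraction formula becomes
  the product of \<open>m - j\<close> over \<open>j < n\<close>, which is zero for
  \<open>m < n\<close> and \<open>fact n\<close> for \<open>m = n\<close>. Up to a factor 2 this is
  the inner product of \<open>L\<^sub>n\<^sup>k\<close> with \<open>r ^ (2 * m + k)\<close> for the
  weight \<open>r dr\<close>.\<close>

lemma radial_coeff_orthogonal:
  assumes "m \<le> n"
  shows "(\<Sum>l=0..n. radial_coeff k l n / real (l + m + k + 1)) =
    (if m = n then fact n / (\<Prod>j=0..n. real (n + k + 1 + j)) else 0)"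
proof -
  have "(\<Sum>l=0..n. radial_coeff k l n / real (l + m + k + 1)) =
     (\<Prod>j<n. real (m + k + 1) - real (j + k + 1)) / (\<Prod>j=0..n. real (m + k + 1) + real j)"
    using radial_coeff_partial_fractions[of "real (m + k + 1)" k n] by (simp add: add_ac)
  also have "(\<Prod>j<n. real (m + k + 1) - real (j + k + 1)) = (if m = n then fact n else 0)"
  proof (cases "m = n")
    case True
    have "(\<Prod>j<n. real (n + k + 1) - real (j + k + 1)) = (\<Prod>j<n. real (n - j))"
      by (intro prod.cong) (auto simp: of_nat_diff)
    also have "\<dots> = fact n"
      by (simp add: fact_prod_rev atLeast0LessThan of_nat_prod)
    finally show ?thesis using True by simp
  next
    case False
    then show ?thesis using assms by (auto intro!: prod_zero bexI[of _ m])
  qed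
  finally show ?thesis by (auto simp: add_ac)
qed

text \<open>For \<open>m \<le> n\<close> orthogonality to lower powers leaves at most the term
  \<open>l = n\<close>, which occurs only if \<open>m = n\<close>. The remaining case follows by
  symmetry.\<close>

lemma radial_coeff_gram:
  "(\<Sum>l=0..m. \<Sum>l'=0..n. radial_coeff k l m * radial_coeff k l' n / real (l + l' + k + 1)) =
    (if m = n then 1 / real (2 * n + k + 1) else 0)"
proof -
  have *: "(\<Sum>l=0..m. \<Sum>l'=0..n. radial_coeff k l m * radial_coeff k l' n / real (l + l' + k + 1)) =
    (if m = n then 1 / real (2 * n + k + 1) else 0)" if "m \<le> n" for m n
  proof -
    have "(\<Sum>l=0..m. \<Sum>l'=0..n. radial_coeff k l m * radial_coeff k l' n / real (l + l' + k + 1)) =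
      (\<Sum>l=0..m. radial_coeff k l m * (\<Sum>l'=0..n. radial_coeff k l' n / real (l' + l + k + 1)))"
      by (simp add: sum_distrib_left add_ac)
    also have "\<dots> = (\<Sum>l=0..m. if l = n then radial_coeff k n m * (fact n / (\<Prod>j=0..n. real (n + k + 1 + j))) else 0)"
      using that by (intro sum.cong refl) (subst radial_coeff_orthogonal, auto)
    also have "\<dots> = (if m = n then radial_coeff k n n * (fact n / (\<Prod>j=0..n. real (n + k + 1 + j))) else 0)"
      using that by auto
    \<comment> \<open>The numerator of the leading coefficient cancels all factors of the
      denominator but the last one, \<open>2 * n + k + 1\<close>.\<close>
    also have "radial_coeff k n n * (fact n / (\<Prod>j=0..n. real (n + k + 1 + j))) = 1 / real (2 * n + k + 1)"
    proof -
      have "(\<Prod>j\<in>{0..n} - {n}. real n - real j) = (\<Prod>j<n. real (n - j))"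
        by (intro prod.cong) (auto simp: of_nat_diff)
      also have "\<dots> = fact n"
        by (simp add: fact_prod_rev atLeast0LessThan of_nat_prod)
      finally have 1: "radial_coeff k n n * fact n = (\<Prod>j<n. real (n + j + k + 1))"
        by (simp add: radial_coeff_def)
      have "{0..n} = insert n {..<n}" by auto
      then have "(\<Prod>j=0..n. real (n + k + 1 + j)) = real (n + k + 1 + n) * (\<Prod>j<n. real (n + k + 1 + j))"
        by simp
      also have "(\<Prod>j<n. real (n + k + 1 + j)) = (\<Prod>j<n. real (n + j + k + 1))"
        by (intro prod.cong) auto
      finally have "(\<Prod>j=0..n. real (n + k + 1 + j)) = (\<Prod>j<n. real (n + j + k + 1)) * real (2 * n + k + 1)"
        by (simp add: mult_2 add_ac mult.commute)
      moreover have "(\<Prod>j<n. real (n + j + k + 1)) > 0" by (intro prod_pos) auto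
      ultimately show ?thesis using 1 by simp
    qed
    finally show ?thesis .
  qed
  show ?thesis
  proof (cases "m \<le> n")
    case False
    then show ?thesis
      using *[of n m] by (subst sum.swap) (simp add: mult.commute add_ac)
  qed (rule *)
qed

text \<open>The denominator splits at \<open>l\<close>: the nodes below give \<open>fact l\<close>,
  the \<open>n - l\<close> nodes above give a signed factorial. This is the shape of the weights in
  \<open>recon_coeff\<close>.\<close>

lemma radial_coeff_eq:
  assumes "l \<le> n"
  shows "radial_coeff k l n = (-1) ^ (n - l) * (\<Prod>j<n. real (1 + k + l + j)) / (fact l * fact (n - l))"
proof -
  have split: "{0..n} - {l} = {..<l} \<union> {l<..n}" using assms by auto
  have "(\<Prod>j\<in>{0..n} - {l}. real l - real j) = (\<Prod>j<l. real l - real j) * (\<Prod>j\<in>{l<..n}. real l - real j)"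
    unfolding split by (rule prod.union_disjoint) auto
  also have "(\<Prod>j<l. real l - real j) = (\<Prod>j<l. real (l - j))"
    by (intro prod.cong) (auto simp: of_nat_diff)
  also have "\<dots> = fact l"
    by (simp add: fact_prod_rev atLeast0LessThan of_nat_prod)
  also have "(\<Prod>j\<in>{l<..n}. real l - real j) = (\<Prod>j\<in>{1..n - l}. - real j)"
    using assms by (intro prod.reindex_bij_witness[of _ "\<lambda>j. j + l" "\<lambda>j. j - l"]) (auto simp: of_nat_diff)
  also have "\<dots> = (\<Prod>j\<in>{1..n - l}. - 1 * real j)" by simp
  also have "\<dots> = (-1) ^ (n - l) * fact (n - l)"
    by (subst prod.distrib) (simp add: fact_prod of_nat_prod)
  finally have *: "(\<Prod>j\<in>{0..n} - {l}. real l - real j) = (-1) ^ (n - l) * (fact l * fact (n - l))"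
    by (simp only: mult.left_commute)
  have **: "(\<Prod>j<n. real (l + j + k + 1)) = (\<Prod>j<n. real (1 + k + l + j))"
    by (intro prod.cong) auto
  have "N / ((-1) ^ m * F) = (-1) ^ m * N / F" for N F :: real and m :: nat
    by (simp add: minus_one_power_iff)
  then have "A / ((-1) ^ (n - l) * (fact l * fact (n - l))) = (-1) ^ (n - l) * A / (fact l * fact (n - l))"
    for A :: real .
  then show ?thesis
    by (simp only: radial_coeff_def * **)
qed


section \<open>Harmonic extensions of trigonometric functions\<close>

text \<open>
  The gradient of \<open>Re f\<close> for holomorphic \<open>f\<close> is the complex conjugate of \<open>f'\<close>.
\<close>

definition cpx_grad :: "complex \<Rightarrow> real \<times> real" where
  "cpx_grad w = (Re w, - Im w)"

lemma bounded_linear_cpx_grad: "bounded_linear cpx_grad"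
  unfolding cpx_grad_def
  by (intro bounded_linear_Pair bounded_linear_minus bounded_linear_Re bounded_linear_Im)

lemma inner_cpx_grad: "h \<bullet> cpx_grad w = Re (w * cpx h)"
  by (cases h) (simp add: cpx_grad_def cpx_def)

lemma cpx_grad_inner_cpx_grad: "cpx_grad v \<bullet> cpx_grad w = Re (v * cnj w)"
  by (simp add: cpx_grad_def)

section \<open>Gradients and harmonicity of real parts of powers\<close>

lemma Basis_real_prod: "(Basis :: (real \<times> real) set) = {(1, 0), (0, 1)}"
  by (auto simp: Basis_prod_def)

lemma gradient_eqI: "GDERIV u x :> D \<Longrightarrow> gradient u x = D"
proof -
  assume D: "GDERIV u x :> D"
  have "D' = D" if "GDERIV u x :> D'" for D'
  proof -
    have "h \<bullet> D' = h \<bullet> D" for h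
      using has_derivative_unique[OF that[unfolded gderiv_def] D[unfolded gderiv_def]] by (rule fun_cong)
    then show ?thesis using vector_eq_ldot by blast
  qed
  then show ?thesis unfolding gradient_def using D by (intro the_equality)
qed

text \<open>A linear functional is the inner product with the vector of its values on the basis, so
  the definite description in \<open>gradient\<close> denotes something.\<close>

lemma gradient_of_differentiable:
  fixes u :: "'a::euclidean_space \<Rightarrow> real"
  assumes "u differentiable (at x)"
  shows "GDERIV u x :> gradient u x"
proof -
  obtain u' where u': "(u has_derivative u') (at x)" using assms by (auto simp: differentiable_def)
  then interpret bounded_linear u' by (rule has_derivative_bounded_linear)
  have "u' h = h \<bullet> (\<Sum>b\<in>Basis. u' b *\<^sub>R b)" for h
  proof -
    have "u' h = u' (\<Sum>b\<in>Basis. (h \<bullet> b) *\<^sub>R b)" by (simp add: euclidean_representation)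
    also have "\<dots> = (\<Sum>b\<in>Basis. (h \<bullet> b) * u' b)" by (simp only: sum scale real_scaleR_def)
    finally show ?thesis by (simp add: inner_sum_right mult.commute)
  qed
  then obtain D where "u' = (\<lambda>h. h \<bullet> D)" by blast
  then have D: "GDERIV u x :> D" using u' by (simp add: gderiv_def)
  show ?thesis unfolding gradient_eqI[OF D] by (rule D)
qed

lemma has_derivative_cpx_power:
  "((\<lambda>z. c * cpx z ^ n) has_derivative (\<lambda>h. c * of_nat n * cpx z ^ (n - 1) * cpx h)) (at z)"
  by (rule has_derivative_eq_rhs, rule has_derivative_mult_right,
      rule has_derivative_power[OF bounded_linear_imp_has_derivative[OF bounded_linear_cpx]])
     (auto simp: mult_ac)

lemma GDERIV_Re_cpx_power:
  "GDERIV (\<lambda>z. Re (c * cpx z ^ n)) z :> cpx_grad (c * of_nat n * cpx z ^ (n - 1))"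
  unfolding gderiv_def inner_cpx_grad
  by (rule bounded_linear.has_derivative[OF bounded_linear_Re has_derivative_cpx_power])

lemma gradient_Re_cpx_power:
  "gradient (\<lambda>z. Re (c * cpx z ^ n)) = (\<lambda>z. cpx_grad (c * of_nat n * cpx z ^ (n - 1)))"
  using gradient_eqI[OF GDERIV_Re_cpx_power] by blast

text \<open>The derivative of the gradient in direction \<open>h\<close> is
  \<open>cpx_grad (w * h)\<close> with \<open>w\<close> the second complex derivative; its trace is
  \<open>Re w - Im (\<i> * w) = 0\<close>.\<close>

lemma harmonic_on_Re_cpx_power: "harmonic_on (\<lambda>z. Re (c * cpx z ^ n)) S"
proof -
  let ?u = "\<lambda>z. Re (c * cpx z ^ n)"
  let ?w = "\<lambda>z. c * of_nat n * of_nat (n - 1) * cpx z ^ (n - 1 - 1)"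
  have D: "(gradient ?u has_derivative (\<lambda>h. cpx_grad (?w z * cpx h))) (at z)" for z
    unfolding gradient_Re_cpx_power
    by (rule bounded_linear.has_derivative[OF bounded_linear_cpx_grad has_derivative_cpx_power])
  then have F: "frechet_derivative (gradient ?u) (at z) = (\<lambda>h. cpx_grad (?w z * cpx h))" for z
    by (metis frechet_derivative_at)
  have "C2_on ?u S"
    unfolding C2_on_def F
  proof (intro conjI ballI)
    show "?u differentiable at z" for z
      using GDERIV_Re_cpx_power unfolding gderiv_def differentiable_def by blast
    show "gradient ?u differentiable at z" for z using D unfolding differentiable_def by blast
    show "continuous_on S (\<lambda>z. cpx_grad (?w z * cpx b))" for b
      by (intro bounded_linear.continuous_on[OF bounded_linear_cpx_grad] continuous_intros)
  qed
  moreover have "laplacian ?u z = 0" for z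
    unfolding laplacian_def F Basis_real_prod by (simp add: cpx_grad_def cpx_def)
  ultimately show ?thesis by (simp add: harmonic_on_def)
qed

text \<open>The complex coefficient \<open>c\<close> treats both kinds of data at once:
  \<open>c = 1\<close> gives the cosine, \<open>c = - \<i>\<close> the sine.\<close>

lemma dirichlet_solution_Re_cpx_power:
  "dirichlet_solution (\<lambda>\<phi>. Re (c * cis (real n * \<phi>))) (\<lambda>z. Re (c * cpx z ^ n))"
proof -
  have "cpx (cos \<phi>, sin \<phi>) ^ n = cis (real n * \<phi>)" for \<phi>
  proof -
    have "cpx (cos \<phi>, sin \<phi>) = cis \<phi>" by (simp add: cpx_def complex_eq_iff)
    then show ?thesis by (simp only: Complex.DeMoivre)
  qed
  moreover have "continuous_on (closure unit_disc) (\<lambda>z. Re (c * cpx z ^ n))"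
    by (intro continuous_intros)
  ultimately show ?thesis
    unfolding dirichlet_solution_def using harmonic_on_Re_cpx_power by metis
qed

section \<open>Uniqueness for the Dirichlet problem\<close>

lemma second_derivative_nonpos_at_local_max:
  fixes f :: "real \<Rightarrow> real"
  assumes "d > 0" and f: "\<And>t. \<bar>t\<bar> < d \<Longrightarrow> (f has_real_derivative f' t) (at t)"
    and f': "(f' has_real_derivative D) (at 0)"
    and max: "\<And>t. \<bar>t\<bar> < d \<Longrightarrow> f t \<le> f 0"
  shows "D \<le> 0"
proof (rule ccontr)
  assume "\<not> D \<le> 0"
  \<comment> \<open>With \<open>D > 0\<close>, \<open>f'\<close> exceeds \<open>f' 0 = 0\<close>
    just to the right of the maximum, so \<open>f\<close> would increase strictly there.\<close>
  then obtain e where e: "e > 0" "\<And>h. 0 < h \<Longrightarrow> h < e \<Longrightarrow> f' 0 < f' (0 + h)"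
    using DERIV_pos_inc_right[OF f'] by auto
  have "f' 0 = 0"
    by (rule DERIV_local_max[OF f[of 0] \<open>d > 0\<close>]) (use max \<open>d > 0\<close> in auto)
  define t where "t = min d e / 2"
  have t: "0 < t" "t < d" "t < e" using e \<open>d > 0\<close> by (auto simp: t_def)
  have "f 0 < f t"
  proof (rule DERIV_pos_imp_increasing_open[OF t(1)])
    show "\<exists>y. (f has_real_derivative y) (at x) \<and> 0 < y" if "0 < x" "x < t" for x
      using f[of x] e(2)[of x] that t \<open>f' 0 = 0\<close> by (intro exI[of _ "f' x"]) auto
    show "continuous_on {0..t} f"
      using t f by (intro continuous_at_imp_continuous_on ballI) (force intro: DERIV_isCont)
  qed
  then show False using max[of t] t by simp
qed

text \<open>The weak maximum principle. Used in both directions it shows that the choice operator in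
  \<open>harmonic_extension\<close> picks the known solution on the disc.\<close>

lemma dirichlet_solution_le:
  assumes u: "dirichlet_solution f u" and v: "dirichlet_solution f v" and "x1 \<in> cball 0 1"
  shows "u x1 \<le> v x1"
proof (rule ccontr)
  assume "\<not> u x1 \<le> v x1"
  define \<delta> where "\<delta> = u x1 - v x1"
  then have "\<delta> > 0" using \<open>\<not> u x1 \<le> v x1\<close> by simp
  \<comment> \<open>The quadratic term has a positive Laplacian and is too small to move the maximum to the circle.\<close>
  define w where "w x = u x - v x + \<delta> / 2 * (x \<bullet> x)" for x
  have "continuous_on (cball 0 1) w"
    using u v unfolding w_def dirichlet_solution_def closure_unit_disc
    by (intro continuous_intros) auto
  then obtain x0 where x0: "x0 \<in> cball 0 1" "\<And>x. x \<in> cball 0 1 \<Longrightarrow> w x \<le> w x0"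
    using continuous_attains_sup[of "cball 0 1" w] by auto
  have "norm x0 \<noteq> 1"
  proof
    assume "norm x0 = 1"
    then have "(fst x0)\<^sup>2 + (snd x0)\<^sup>2 = 1" by (cases x0) (simp add: norm_Pair)
    then obtain \<phi> where "x0 = (cos \<phi>, sin \<phi>)" by (metis sincos_total_2pi prod.collapse)
    then have "u x0 = v x0" using u v by (simp add: dirichlet_solution_def)
    then have "w x0 = \<delta> / 2" using \<open>norm x0 = 1\<close> by (simp add: w_def dot_square_norm)
    moreover have "\<delta> \<le> w x1" using \<open>\<delta> > 0\<close> by (simp add: w_def \<delta>_def[symmetric])
    ultimately show False using x0(2)[OF assms(3)] \<open>\<delta> > 0\<close> by linarith
  qed
  then have "x0 \<in> unit_disc" using x0 by (simp add: unit_disc_eq_ball)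
  then obtain d where d: "d > 0" "ball x0 d \<subseteq> unit_disc"
    using open_unit_disc open_contains_ball by blast
  have C2: "C2_on u unit_disc" "C2_on v unit_disc"
    and lap: "laplacian u x0 = 0" "laplacian v x0 = 0"
    using u v \<open>x0 \<in> unit_disc\<close> by (auto simp: dirichlet_solution_def harmonic_on_def)
  let ?D = "\<lambda>u. frechet_derivative (gradient u) (at x0)"
  \<comment> \<open>At the interior maximum each second directional derivative of \<open>w\<close>
    is nonpositive, and the quadratic term contributes \<delta> to each. Summing over the two axes
    contradicts the vanishing Laplacians.\<close>
  have "(?D u b - ?D v b) \<bullet> b + \<delta> \<le> 0" if b: "b \<in> Basis" for b
  proof (rule second_derivative_nonpos_at_local_max[OF d(1)])
    let ?p = "\<lambda>t. x0 + t *\<^sub>R b"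
    have p: "?p t \<in> unit_disc" if "\<bar>t\<bar> < d" for t
      using d(2) that b by (auto simp: dist_norm)
    have p': "(?p has_derivative (\<lambda>h. h *\<^sub>R b)) (at t)" for t
      by (auto intro!: derivative_eq_intros)
    show "w (?p t) \<le> w (?p 0)" if "\<bar>t\<bar> < d" for t
      using x0(2)[of "?p t"] p[OF that] by (simp add: unit_disc_eq_ball)
    show "((\<lambda>t. w (?p t)) has_real_derivative
        (gradient u (?p t) - gradient v (?p t)) \<bullet> b + \<delta> * (?p t \<bullet> b)) (at t)" if "\<bar>t\<bar> < d" for t
    proof -
      have "(g has_derivative (\<lambda>h. h \<bullet> gradient g (?p t))) (at (?p t))" if "C2_on g unit_disc" for g
        using gradient_of_differentiable p[OF \<open>\<bar>t\<bar> < d\<close>] that by (auto simp: C2_on_def gderiv_def)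
      note g = has_derivative_compose[OF p' this]
      have "((\<lambda>t. w (?p t)) has_derivative
         (\<lambda>h. (h *\<^sub>R b) \<bullet> gradient u (?p t) - (h *\<^sub>R b) \<bullet> gradient v (?p t)
           + \<delta> / 2 * (?p t \<bullet> (h *\<^sub>R b) + (h *\<^sub>R b) \<bullet> ?p t))) (at t)"
        unfolding w_def
        by (intro has_derivative_add has_derivative_diff g C2 has_derivative_mult_right
            has_derivative_inner p')
      then show ?thesis
        unfolding has_field_derivative_def
        by (rule has_derivative_eq_rhs) (auto simp: inner_commute algebra_simps)
    qed
    have "((\<lambda>t. gradient g (?p t)) has_derivative (\<lambda>h. ?D g (h *\<^sub>R b))) (at 0)"
      if "C2_on g unit_disc" for g
    proof (rule has_derivative_compose[OF p'])
      show "(gradient g has_derivative ?D g) (at (?p 0))"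
        using that \<open>x0 \<in> unit_disc\<close> by (auto simp: C2_on_def frechet_derivative_works)
    qed
    note g = this[OF C2(1)] this[OF C2(2)]
    have lin: "?D g (h *\<^sub>R b) = h *\<^sub>R ?D g b" if "C2_on g unit_disc" for g h
      using that \<open>x0 \<in> unit_disc\<close>
      by (intro linear_scale linear_frechet_derivative) (auto simp: C2_on_def)
    have "((\<lambda>t. (gradient u (?p t) - gradient v (?p t)) \<bullet> b + \<delta> * (?p t \<bullet> b)) has_derivative
        (\<lambda>h. (?D u (h *\<^sub>R b) - ?D v (h *\<^sub>R b)) \<bullet> b + \<delta> * ((h *\<^sub>R b) \<bullet> b))) (at 0)"
      by (intro has_derivative_add has_derivative_diff has_derivative_inner_left g
          has_derivative_mult_right p')
    then show "((\<lambda>t. (gradient u (?p t) - gradient v (?p t)) \<bullet> b + \<delta> * (?p t \<bullet> b)) has_real_derivative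
        (?D u b - ?D v b) \<bullet> b + \<delta>) (at 0)"
      unfolding has_field_derivative_def
      by (rule has_derivative_eq_rhs) (use b in \<open>auto simp: lin C2 algebra_simps\<close>)
  qed
  then have "(\<Sum>b\<in>Basis. (?D u b - ?D v b) \<bullet> b + \<delta>) \<le> 0" by (intro sum_nonpos) auto
  also have "(\<Sum>b\<in>Basis. (?D u b - ?D v b) \<bullet> b + \<delta>) = laplacian u x0 - laplacian v x0 + 2 * \<delta>"
    by (simp add: laplacian_def inner_diff_left sum.distrib sum_subtractf)
  finally show False using lap \<open>\<delta> > 0\<close> by simp
qed

text \<open>By uniqueness the extension equals \<open>Re (c * cpx z ^ n)\<close> on the open disc,
  and the gradient depends on values near \<open>z\<close> only.\<close>

lemma gradient_harmonic_extension:
  assumes "z \<in> unit_disc"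
  shows "gradient (harmonic_extension (\<lambda>\<phi>. Re (c * cis (real n * \<phi>)))) z =
    cpx_grad (c * of_nat n * cpx z ^ (n - 1))"
proof (rule gradient_eqI)
  let ?f = "\<lambda>\<phi>. Re (c * cis (real n * \<phi>))" and ?u = "\<lambda>z. Re (c * cpx z ^ n)"
  have u: "dirichlet_solution ?f ?u" by (rule dirichlet_solution_Re_cpx_power)
  then have v: "dirichlet_solution ?f (harmonic_extension ?f)"
    unfolding harmonic_extension_def by (rule someI[where P = "dirichlet_solution ?f"])
  have eq: "?u x = harmonic_extension ?f x" if "x \<in> unit_disc" for x
    using dirichlet_solution_le[OF u v, of x] dirichlet_solution_le[OF v u, of x] that
    by (force simp: unit_disc_eq_ball)
  show "GDERIV (harmonic_extension ?f) z :> cpx_grad (c * of_nat n * cpx z ^ (n - 1))"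
    using GDERIV_Re_cpx_power[of c n z] unfolding gderiv_def
    by (rule has_derivative_transform_within_open[OF _ open_unit_disc assms eq])
qed

lemma lin_DN_trigonometric:
  "lin_DN \<gamma> (\<lambda>\<phi>. Re (c * cis (real i * \<phi>))) (\<lambda>\<phi>. Re (d * cis (real j * \<phi>))) =
    (\<integral>z. \<gamma> z * (real i * real j * Re (c * cnj d * (cpx z ^ (i - 1) * cnj (cpx z) ^ (j - 1)))) \<partial>disc_measure)"
proof -
  have *: "Re (c * of_nat i * a * cnj (d * of_nat j * b)) = real i * real j * Re (c * cnj d * (a * cnj b))" for a b
  proof -
    have "c * of_nat i * a * cnj (d * of_nat j * b) = of_real (real i * real j) * (c * cnj d * (a * cnj b))"
      by (simp add: mult_ac)
    then show ?thesis by (simp only: scaleR_conv_of_real[symmetric] scaleR_complex.sel)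
  qed
  have "gradient (harmonic_extension (\<lambda>\<phi>. Re (c * cis (real i * \<phi>)))) z \<bullet>
      gradient (harmonic_extension (\<lambda>\<phi>. Re (d * cis (real j * \<phi>)))) z =
      real i * real j * Re (c * cnj d * (cpx z ^ (i - 1) * cnj (cpx z) ^ (j - 1)))" if "z \<in> unit_disc" for z
    unfolding gradient_harmonic_extension[OF that] cpx_grad_inner_cpx_grad * complex_cnj_power ..
  note eq = this
  show ?thesis
    unfolding lin_DN_def
  proof (rule Bochner_Integration.integral_cong[OF refl])
    fix z assume "z \<in> space disc_measure"
    then have "z \<in> unit_disc" by simp
    then show "\<gamma> z * (gradient (harmonic_extension (\<lambda>\<phi>. Re (c * cis (real i * \<phi>)))) z \<bullet>
      gradient (harmonic_extension (\<lambda>\<phi>. Re (d * cis (real j * \<phi>)))) z) =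
      \<gamma> z * (real i * real j * Re (c * cnj d * (cpx z ^ (i - 1) * cnj (cpx z) ^ (j - 1))))"
      by (simp only: eq)
  qed
qed


section \<open>Zernike polynomials\<close>

text \<open>Writing \<open>r ^ (2 * l + k) * cis (k * phi)\<close> as
  \<open>z ^ (l + k) * cnj z ^ l\<close> makes this a polynomial, continuous at the origin and
  integrable through \<open>moment\<close>.\<close>

definition zernike :: "nat \<Rightarrow> nat \<Rightarrow> real \<times> real \<Rightarrow> complex" where
  "zernike k n z = (\<Sum>l=0..n. of_real (radial_coeff k l n) * (cpx z ^ (l + k) * cnj (cpx z) ^ l))"

lemma continuous_on_zernike [continuous_intros]: "continuous_on S (zernike k n)"
  unfolding zernike_def by (intro continuous_intros)

text \<open>The unimodular factor satisfies \<open>w * cnj w = 1\<close>, leaving only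
  \<open>w ^ k\<close>. At the origin the default value of the angle is harmless, since
  \<open>cpx z = r * w\<close> with \<open>r = 0\<close>.\<close>

lemma zernike_polar:
  "zernike k n z = of_real (radial_poly k n (polar_radius z)) * cis (real k * polar_angle z)"
proof -
  let ?r = "polar_radius z" and ?w = "cis (polar_angle z)"
  have z: "cpx z = of_real ?r * ?w"
    using rcis_cmod_Arg[of "cpx z"]
    by (simp add: rcis_def cpx_def polar_radius_def polar_angle_def cmod_def)
  have w: "?w * cnj ?w = 1" by (simp add: cis_cnj cis_mult)
  have "cpx z ^ (l + k) * cnj (cpx z) ^ l = of_real (?r ^ (2 * l + k)) * ?w ^ k" for l
  proof -
    have "cpx z ^ (l + k) * cnj (cpx z) ^ l = of_real (?r ^ (2 * l + k)) * ?w ^ k * (?w * cnj ?w) ^ l"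
      unfolding z by (simp add: power_add power_mult_distrib mult_2 mult_2_right mult_ac)
    then show ?thesis by (simp only: w power_one mult_1_right)
  qed
  then show ?thesis
    by (simp add: zernike_def radial_poly_def sum_distrib_right Complex.DeMoivre mult.assoc)
qed

section \<open>Orthogonality of the Zernike polynomials\<close>

lemma integrable_cpx_monomial: "integrable disc_measure (\<lambda>z. cpx z ^ a * cnj (cpx z) ^ b)"
  by (intro integrable_disc_continuous continuous_intros)

text \<open>The two exponents of each monomial differ by \<open>j - k\<close>, so only
  \<open>j = k\<close> survives, and then the radial Gram matrix remains.\<close>

lemma integral_zernike_mult_cnj:
  "(\<integral>z. zernike j m z * cnj (zernike k n z) \<partial>disc_measure) =
    (if j = k \<and> m = n then of_real (pi / real (2 * n + k + 1)) else 0)"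
proof -
  have "zernike j m z * cnj (zernike k n z) = (\<Sum>l=0..m. \<Sum>l'=0..n.
      of_real (radial_coeff j l m * radial_coeff k l' n) * (cpx z ^ (l + j + l') * cnj (cpx z) ^ (l + l' + k)))" for z
    unfolding zernike_def sum_product cnj_sum by (intro sum.cong refl) (simp add: power_add mult_ac)
  then have "(\<integral>z. zernike j m z * cnj (zernike k n z) \<partial>disc_measure) = (\<Sum>l=0..m. \<Sum>l'=0..n.
      of_real (radial_coeff j l m * radial_coeff k l' n) * moment (l + j + l') (l + l' + k))"
    using integrable_cpx_monomial by (simp add: moment_def)
  also have "\<dots> = (if j = k then of_real (pi * (\<Sum>l=0..m. \<Sum>l'=0..n.
      radial_coeff k l m * radial_coeff k l' n / real (l + l' + k + 1))) else 0)"
    by (auto simp: moment_eq sum_distrib_left add_ac intro!: sum.cong)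
  also have "\<dots> = (if j = k \<and> m = n then of_real (pi / real (2 * n + k + 1)) else 0)"
    unfolding radial_coeff_gram by auto
  finally show ?thesis .
qed

lemma zernike_0_real: "cnj (zernike 0 n z) = zernike 0 n z"
  unfolding zernike_polar by simp

text \<open>Without conjugation the exponents differ by \<open>j + k\<close>, so everything vanishes
  unless \<open>j = k = 0\<close>, where the polynomials are real.\<close>

lemma integral_zernike_mult:
  "(\<integral>z. zernike j m z * zernike k n z \<partial>disc_measure) =
    (if j = 0 \<and> k = 0 \<and> m = n then of_real (pi / real (2 * n + k + 1)) else 0)"
proof (cases "j = 0 \<and> k = 0")
  case True
  then show ?thesis using integral_zernike_mult_cnj[of 0 m 0 n] by (simp add: zernike_0_real)
next
  case False
  have "zernike j m z * zernike k n z = (\<Sum>l=0..m. \<Sum>l'=0..n.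
      of_real (radial_coeff j l m * radial_coeff k l' n) * (cpx z ^ (l + j + l' + k) * cnj (cpx z) ^ (l + l')))" for z
    unfolding zernike_def sum_product by (intro sum.cong refl) (simp add: power_add mult_ac)
  then have "(\<integral>z. zernike j m z * zernike k n z \<partial>disc_measure) = (\<Sum>l=0..m. \<Sum>l'=0..n.
      of_real (radial_coeff j l m * radial_coeff k l' n) * moment (l + j + l' + k) (l + l'))"
    using integrable_cpx_monomial by (simp add: moment_def)
  also have "\<dots> = 0"
    using False by (intro sum.neutral ballI) (auto simp: moment_eq)
  finally show ?thesis using False by auto
qed

text \<open>\<open>Re X * Re Y\<close> is the mean of \<open>Re (X * Y)\<close> and
  \<open>Re (X * cnj Y)\<close>. The first contributes for \<open>k = 0\<close> only: it doubles the
  squared norm of the cosine and annihilates the sine.\<close>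

lemma integral_Re_zernike_mult:
  "(\<integral>z. Re (c * zernike j m z) * Re (d * zernike k n z) \<partial>disc_measure) =
    (if j = k \<and> m = n
     then (Re (c * cnj d) + (if k = 0 then Re (c * d) else 0)) * (pi / (2 * real (2 * n + k + 1))) else 0)"
proof -
  have eq: "Re (c * a) * Re (d * b) = Re (c * d * (a * b)) / 2 + Re (c * cnj d * (a * cnj b)) / 2" for a b
  proof -
    have "Re X * Re Y = Re (X * Y) / 2 + Re (X * cnj Y) / 2" for X Y
      by (simp add: field_simps)
    from this[of "c * a" "d * b"] show ?thesis by (simp only: complex_cnj_mult mult_ac)
  qed
  have int: "integrable disc_measure (\<lambda>z. zernike j m z * zernike k n z)"
    "integrable disc_measure (\<lambda>z. zernike j m z * cnj (zernike k n z))"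
    by (intro integrable_disc_continuous continuous_intros)+
  have "(\<integral>z. Re (c * zernike j m z) * Re (d * zernike k n z) \<partial>disc_measure) =
    Re (c * d * (\<integral>z. zernike j m z * zernike k n z \<partial>disc_measure)) / 2 +
    Re (c * cnj d * (\<integral>z. zernike j m z * cnj (zernike k n z) \<partial>disc_measure)) / 2"
    unfolding eq using int
    by (simp only: integral_mult_right_zero[symmetric] integral_Re[symmetric]
      integral_divide_zero[symmetric] Bochner_Integration.integral_add integrable_Re
      integrable_mult_right integrable_divide_zero)
  also have "\<dots> = (if j = k \<and> m = n
     then (Re (c * cnj d) + (if k = 0 then Re (c * d) else 0)) * (pi / (2 * real (2 * n + k + 1))) else 0)"
  proof -
    define P where "P = pi / real (2 * n + k + 1)"
    have P: "pi / (2 * real (2 * n + k + 1)) = P / 2" by (simp add: P_def)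
    have "Re (x * (if j = 0 \<and> k = 0 \<and> m = n then of_real P else 0)) / 2 +
      Re (y * (if j = k \<and> m = n then of_real P else 0)) / 2 =
      (if j = k \<and> m = n then (Re y + (if k = 0 then Re x else 0)) * (P / 2) else 0)" for x y
      by (auto simp: field_simps)
    then show ?thesis
      unfolding integral_zernike_mult integral_zernike_mult_cnj P P_def[symmetric] .
  qed
  finally show ?thesis .
qed

section \<open>Reconstruction coefficients as Fourier coefficients\<close>

lemma L2_fun_Re_zernike: "L2_fun disc_measure (\<lambda>z. Re (c * zernike k n z))"
  by (intro L2_fun_continuous continuous_intros)

text \<open>The divisor \<open>(l + 1) * (l + 1 + k)\<close> in \<open>recon_coeff\<close> cancels
  the factors from differentiating the two powers, and the remaining weights are those of the radial
  polynomial.\<close>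

lemma recon_coeff_lin_DN:
  assumes "L2_fun disc_measure \<gamma>"
  shows "recon_coeff (\<lambda>i j. lin_DN \<gamma> (\<lambda>\<phi>. Re (1 * cis (real i * \<phi>))) (\<lambda>\<phi>. Re (d * cis (real j * \<phi>)))) n k =
    2 * real (2 * n + k + 1) / pi * (\<integral>z. Re (d * zernike k n z) * \<gamma> z \<partial>disc_measure)"
proof -
  define J where "J l = (\<integral>z. Re (d * (cpx z ^ (l + k) * cnj (cpx z) ^ l)) * \<gamma> z \<partial>disc_measure)" for l
  have int: "integrable disc_measure (\<lambda>z. Re (d * (cpx z ^ (l + k) * cnj (cpx z) ^ l)) * \<gamma> z)" for l
    by (intro L2_fun_mult_integrable[OF _ assms] L2_fun_continuous continuous_intros)
  have K: "lin_DN \<gamma> (\<lambda>\<phi>. Re (1 * cis (real (l + 1) * \<phi>))) (\<lambda>\<phi>. Re (d * cis (real (l + 1 + k) * \<phi>))) =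
    real (l + 1) * real (l + 1 + k) * J l" for l
  proof -
    \<comment> \<open>The form yields the conjugate of the wanted monomial, which has the same real
      part.\<close>
    have eq: "Re (1 * cnj d * (cpx z ^ (l + 1 - 1) * cnj (cpx z) ^ (l + 1 + k - 1))) =
      Re (d * (cpx z ^ (l + k) * cnj (cpx z) ^ l))" for z
    proof -
      have "1 * cnj d * (cpx z ^ (l + 1 - 1) * cnj (cpx z) ^ (l + 1 + k - 1)) =
        cnj (d * (cpx z ^ (l + k) * cnj (cpx z) ^ l))" by (simp add: mult_ac)
      then show ?thesis by (simp only: cnj.sel)
    qed
    show ?thesis
      unfolding lin_DN_trigonometric J_def eq
      by (subst integral_mult_right_zero[symmetric]) (simp add: mult_ac)
  qed
  have "recon_coeff (\<lambda>i j. lin_DN \<gamma> (\<lambda>\<phi>. Re (1 * cis (real i * \<phi>))) (\<lambda>\<phi>. Re (d * cis (real j * \<phi>)))) n k =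
    (\<Sum>l=0..n. 2 * real (2 * n + k + 1) / pi * (radial_coeff k l n * J l))"
    unfolding recon_coeff_def K
  proof (intro sum.cong refl)
    fix l assume "l \<in> {0..n}"
    then have c: "radial_coeff k l n = (-1) ^ (n - l) * (\<Prod>j<n. real (1 + k + l + j)) / (fact l * fact (n - l))"
      by (intro radial_coeff_eq) simp
    have "a * b * J l / (a * b * pi) = J l / pi" if "a > 0" "b > 0" for a b :: real
      using that by simp
    from this[of "real (l + 1)" "real (l + 1 + k)"]
    have J: "real (l + 1) * real (l + 1 + k) * J l / (real (l + 1) * real (l + 1 + k) * pi) = J l / pi" by simp
    show "2 * (-1) ^ (n - l) * real (2 * n + k + 1) * ((\<Prod>j<n. real (1 + k + l + j)) / (fact l * fact (n - l))) *
      (real (l + 1) * real (l + 1 + k) * J l / (real (l + 1) * real (l + 1 + k) * pi)) =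
      2 * real (2 * n + k + 1) / pi * (radial_coeff k l n * J l)"
      unfolding J c by (simp only: times_divide_eq_left times_divide_eq_right mult_ac)
  qed
  also have "\<dots> = 2 * real (2 * n + k + 1) / pi * (\<Sum>l=0..n. radial_coeff k l n * J l)"
    by (simp only: sum_distrib_left)
  also have "(\<Sum>l=0..n. radial_coeff k l n * J l) = (\<integral>z. Re (d * zernike k n z) * \<gamma> z \<partial>disc_measure)"
  proof -
    have "Re (d * zernike k n z) * \<gamma> z =
      (\<Sum>l=0..n. radial_coeff k l n * (Re (d * (cpx z ^ (l + k) * cnj (cpx z) ^ l)) * \<gamma> z))" for z
    proof -
      have "d * zernike k n z = (\<Sum>l=0..n. radial_coeff k l n *\<^sub>R (d * (cpx z ^ (l + k) * cnj (cpx z) ^ l)))"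
        by (simp only: zernike_def sum_distrib_left scaleR_conv_of_real mult.left_commute)
      then show ?thesis by (simp only: Re_sum scaleR_complex.sel sum_distrib_right mult.assoc)
    qed
    then show ?thesis using int by (simp add: J_def)
  qed
  finally show ?thesis .
qed

text \<open>The prefactor of the coefficient is the reciprocal squared norm for
  \<open>k \<ge> 1\<close> and unimodular \<open>d\<close>. For \<open>k = 0\<close> and
  \<open>d = 1\<close> the right side carries a factor 2, the source of the \<open>1/2\<close> in
  the formula.\<close>

lemma zernike_projection:
  assumes "L2_fun disc_measure \<gamma>"
  shows "recon_coeff (\<lambda>i j. lin_DN \<gamma> (\<lambda>\<phi>. Re (1 * cis (real i * \<phi>))) (\<lambda>\<phi>. Re (d * cis (real j * \<phi>)))) n k *
      (\<integral>z. (Re (d * zernike k n z))\<^sup>2 \<partial>disc_measure) =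
    (Re (d * cnj d) + (if k = 0 then Re (d * d) else 0)) * (\<integral>z. Re (d * zernike k n z) * \<gamma> z \<partial>disc_measure)"
proof -
  have "(\<integral>z. (Re (d * zernike k n z))\<^sup>2 \<partial>disc_measure) =
    (Re (d * cnj d) + (if k = 0 then Re (d * d) else 0)) * (pi / (2 * real (2 * n + k + 1)))"
    using integral_Re_zernike_mult[of d k n d k n] by (simp only: power2_eq_square simp_thms if_True)
  moreover have "2 * b / pi * I * (u * (pi / (2 * b))) = u * I" if "b > 0" for b I u :: real
    using that by simp
  ultimately show ?thesis
    unfolding recon_coeff_lin_DN[OF assms] by simp
qed


section \<open>Completeness\<close>

text \<open>The complex polynomials in \<open>z\<close> and \<open>cnj z\<close>; the inductive form
  lets linear statements be proved by rule induction.\<close>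

inductive monomial_span :: "(real \<times> real \<Rightarrow> complex) \<Rightarrow> bool" where
  monomial: "monomial_span (\<lambda>z. cpx z ^ a * cnj (cpx z) ^ b)"
| add: "monomial_span f \<Longrightarrow> monomial_span g \<Longrightarrow> monomial_span (\<lambda>z. f z + g z)"
| cmult: "monomial_span f \<Longrightarrow> monomial_span (\<lambda>z. c * f z)"

lemma monomial_span_mult_cpx:
  assumes "monomial_span f"
  shows "monomial_span (\<lambda>z. cpx z * f z)" "monomial_span (\<lambda>z. cnj (cpx z) * f z)"
proof -
  from assms have "monomial_span (\<lambda>z. cpx z * f z) \<and> monomial_span (\<lambda>z. cnj (cpx z) * f z)"
  proof induction
    case (monomial a b)
    then show ?case
      using monomial_span.monomial[of "Suc a" b] monomial_span.monomial[of a "Suc b"]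
      by (simp add: mult_ac)
  next
    case (add f g)
    then show ?case by (auto simp: distrib_left intro: monomial_span.add)
  next
    case (cmult f c)
    then show ?case
      using monomial_span.cmult[of _ c] by (fastforce simp: mult.left_commute)
  qed
  then show "monomial_span (\<lambda>z. cpx z * f z)" "monomial_span (\<lambda>z. cnj (cpx z) * f z)" by auto
qed

text \<open>The arbitrary factor \<open>g\<close> makes the product case two successive applications
  of the induction hypotheses.\<close>

lemma monomial_span_real_polynomial_mult:
  assumes "real_polynomial_function f" "monomial_span g"
  shows "monomial_span (\<lambda>z. of_real (f z) * g z)"
  using assms
proof (induction arbitrary: g)
  case (linear f)
  interpret bounded_linear f by fact
  \<comment> \<open>A real linear form is \<open>2 * Re (a * z)\<close>, with this \<open>a\<close>
    determined by its values on the basis.\<close>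
  define a where "a = (of_real (f (1, 0)) - \<i> * of_real (f (0, 1))) / 2"
  have "of_real (f z) * g z = a * (cpx z * g z) + cnj a * (cnj (cpx z) * g z)" for z
  proof -
    have "f z = f (fst z *\<^sub>R (1, 0) + snd z *\<^sub>R (0, 1))" by simp
    also have "\<dots> = fst z * f (1, 0) + snd z * f (0, 1)" by (simp only: add scale real_scaleR_def)
    finally have "of_real (f z) = a * cpx z + cnj a * cnj (cpx z)"
      by (simp add: a_def complex_eq_iff cpx_def field_simps)
    then show ?thesis by (simp add: algebra_simps)
  qed
  then show ?case
    using monomial_span_mult_cpx[OF linear.prems]
    by (auto intro!: monomial_span.add monomial_span.cmult)
next
  case (const c)
  then show ?case by (rule monomial_span.cmult)
next
  case (add f1 f2)
  then show ?case by (auto simp: distrib_right intro!: monomial_span.add)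
next
  case (mult f1 f2)
  show ?case
    using mult.IH(1)[OF mult.IH(2)[OF mult.prems]] by (simp add: mult.assoc)
qed

lemma continuous_on_monomial_span: "monomial_span f \<Longrightarrow> continuous_on S f"
  by (induction rule: monomial_span.induct) (intro continuous_intros; assumption)+

text \<open>For fixed \<open>k\<close> the passage from the monomials
  \<open>z ^ (l + k) * cnj z ^ l\<close> to Zernike polynomials is triangular with nonzero diagonal.
  Strong induction inverts it, and conjugation supplies the monomials with the larger exponent on
  \<open>cnj z\<close>.\<close>

lemma orthogonal_zernike_imp_orthogonal_polynomial:
  assumes D: "L2_fun disc_measure D"
    and orth: "\<And>k n. (\<integral>z. Re (zernike k n z) * D z \<partial>disc_measure) = 0"
      "\<And>k n. (\<integral>z. Im (zernike k n z) * D z \<partial>disc_measure) = 0"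
    and "real_polynomial_function f"
  shows "(\<integral>z. f z * D z \<partial>disc_measure) = 0"
proof -
  have int: "integrable disc_measure (\<lambda>z. f z * of_real (D z))" if "continuous_on UNIV f" for f :: "_ \<Rightarrow> complex"
  proof -
    have "integrable disc_measure (\<lambda>z. Re (f z) * D z)" "integrable disc_measure (\<lambda>z. Im (f z) * D z)"
      by (intro L2_fun_mult_integrable[OF _ D] L2_fun_continuous continuous_intros that)+
    then have "integrable disc_measure (\<lambda>z. of_real (Re (f z) * D z) + \<i> * of_real (Im (f z) * D z))"
      by (intro Bochner_Integration.integrable_add integrable_mult_right integrable_of_real)
    also have "(\<lambda>z. of_real (Re (f z) * D z) + \<i> * of_real (Im (f z) * D z)) = (\<lambda>z. f z * of_real (D z))"
      by (auto simp: complex_eq_iff)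
    finally show ?thesis .
  qed
  have zer: "(\<integral>z. zernike k n z * of_real (D z) \<partial>disc_measure) = 0" for k n
  proof (rule complex_eqI)
    have i: "integrable disc_measure (\<lambda>z. zernike k n z * of_real (D z))"
      by (intro int continuous_intros)
    show "Re (\<integral>z. zernike k n z * of_real (D z) \<partial>disc_measure) = Re 0"
      using orth(1)[of k n] by (simp add: integral_Re[OF i, symmetric])
    show "Im (\<integral>z. zernike k n z * of_real (D z) \<partial>disc_measure) = Im 0"
      using orth(2)[of k n] by (simp add: integral_Im[OF i, symmetric])
  qed
  have mon: "(\<integral>z. cpx z ^ (l + k) * cnj (cpx z) ^ l * of_real (D z) \<partial>disc_measure) = 0" for k l
  proof (induction l rule: less_induct)
    case (less n)
    have i: "integrable disc_measure (\<lambda>z. cpx z ^ (l + k) * cnj (cpx z) ^ l * of_real (D z))" for l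
      by (intro int continuous_intros)
    have "0 = (\<integral>z. zernike k n z * of_real (D z) \<partial>disc_measure)"
      by (simp add: zer)
    also have "\<dots> = (\<Sum>l=0..n. of_real (radial_coeff k l n) *
        (\<integral>z. cpx z ^ (l + k) * cnj (cpx z) ^ l * of_real (D z) \<partial>disc_measure))"
      unfolding zernike_def sum_distrib_right using i by (simp add: mult.assoc)
    also have "\<dots> = (\<Sum>l=0..n. if l = n then of_real (radial_coeff k n n) *
        (\<integral>z. cpx z ^ (n + k) * cnj (cpx z) ^ n * of_real (D z) \<partial>disc_measure) else 0)"
      by (intro sum.cong refl) (use less in auto)
    also have "\<dots> = of_real (radial_coeff k n n) *
        (\<integral>z. cpx z ^ (n + k) * cnj (cpx z) ^ n * of_real (D z) \<partial>disc_measure)"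
      by simp
    finally have "of_real (radial_coeff k n n) *
        (\<integral>z. cpx z ^ (n + k) * cnj (cpx z) ^ n * of_real (D z) \<partial>disc_measure) = 0"
      by (rule sym)
    moreover have "radial_coeff k n n \<noteq> 0"
    proof -
      have "(\<Prod>j<n. real (1 + k + n + j)) > 0" by (intro prod_pos) auto
      then show ?thesis unfolding radial_coeff_eq[OF order_refl] by simp
    qed
    ultimately show ?case by simp
  qed
  have mon': "(\<integral>z. cpx z ^ a * cnj (cpx z) ^ b * of_real (D z) \<partial>disc_measure) = 0" for a b
  proof (cases "b \<le> a")
    case True
    then show ?thesis using mon[of b "a - b"] by simp
  next
    case False
    have "(\<integral>z. cpx z ^ a * cnj (cpx z) ^ b * of_real (D z) \<partial>disc_measure) =
      (\<integral>z. cnj (cpx z ^ b * cnj (cpx z) ^ a * of_real (D z)) \<partial>disc_measure)"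
      by (simp add: mult_ac)
    also have "\<dots> = cnj (\<integral>z. cpx z ^ b * cnj (cpx z) ^ a * of_real (D z) \<partial>disc_measure)"
      by (rule Bochner_Integration.integral_cnj)
    finally show ?thesis using mon[of a "b - a"] False by simp
  qed
  have "monomial_span g \<Longrightarrow> (\<integral>z. g z * of_real (D z) \<partial>disc_measure) = 0" for g
  proof (induction rule: monomial_span.induct)
    case (add f g)
    have "integrable disc_measure (\<lambda>z. f z * of_real (D z))" "integrable disc_measure (\<lambda>z. g z * of_real (D z))"
      using add.hyps by (simp_all add: int continuous_on_monomial_span)
    then show ?case using add by (simp add: distrib_right)
  next
    case (cmult f c)
    then show ?case by (simp add: mult.assoc)
  qed (rule mon')
  moreover have "monomial_span (\<lambda>z. of_real (f z))"
    using monomial_span_real_polynomial_mult[OF assms(4) monomial_span.monomial[of 0 0]] by simp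
  ultimately have "(\<integral>z. of_real (f z) * of_real (D z) \<partial>disc_measure) = (0 :: complex)" by blast
  then have "complex_of_real (\<integral>z. f z * D z \<partial>disc_measure) = 0"
    by (simp flip: of_real_mult)
  then show ?thesis by simp
qed

section \<open>From polynomial test functions to vanishing almost everywhere\<close>

lemma L2_fun_disc_integrable:
  assumes "L2_fun disc_measure D"
  shows "integrable disc_measure D"
  using L2_fun_mult_integrable[OF L2_fun_continuous[of "\<lambda>_. 1"] assms] by simp

lemma orthogonal_polynomial_imp_orthogonal_continuous:
  assumes D: "L2_fun disc_measure D"
    and orth: "\<And>f. real_polynomial_function f \<Longrightarrow> (\<integral>z. f z * D z \<partial>disc_measure) = 0"
    and f: "continuous_on UNIV f"
  shows "(\<integral>z. f z * D z \<partial>disc_measure) = 0"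
proof -
  let ?C = "\<integral>z. \<bar>D z\<bar> \<partial>disc_measure"
  have Di: "integrable disc_measure (\<lambda>z. \<bar>D z\<bar>)"
    using L2_fun_disc_integrable[OF D] by simp
  have "\<bar>\<integral>z. f z * D z \<partial>disc_measure\<bar> \<le> e" if "e > 0" for e
  proof -
    \<comment> \<open>The tolerance is scaled by the \<open>L\<^sup>1\<close> norm of
      \<open>D\<close>; the added 1 keeps the divisor positive when that norm is zero.\<close>
    have "e / (?C + 1) > 0" using \<open>e > 0\<close> by (intro divide_pos_pos add_nonneg_pos) auto
    then obtain g where g: "real_polynomial_function g" "\<And>z. z \<in> cball 0 1 \<Longrightarrow> \<bar>f z - g z\<bar> < e / (?C + 1)"
      using Stone_Weierstrass_real_polynomial_function[of "cball 0 1" f "e / (?C + 1)"] f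
      by (metis compact_cball continuous_on_subset subset_UNIV)
    have gc: "continuous_on UNIV g"
      using g(1) continuous_on_polymonial_function real_polynomial_function_eq by blast
    have i: "integrable disc_measure (\<lambda>z. f z * D z)" "integrable disc_measure (\<lambda>z. g z * D z)"
      by (intro L2_fun_mult_integrable[OF _ D] L2_fun_continuous f gc)+
    have "(\<integral>z. f z * D z \<partial>disc_measure) = (\<integral>z. f z * D z - g z * D z \<partial>disc_measure)"
      using i orth[OF g(1)] by simp
    also have "\<bar>\<dots>\<bar> \<le> (\<integral>z. \<bar>f z * D z - g z * D z\<bar> \<partial>disc_measure)"
      by (rule integral_abs_bound)
    also have "\<dots> \<le> (\<integral>z. e / (?C + 1) * \<bar>D z\<bar> \<partial>disc_measure)"
    proof (rule integral_mono)
      show "\<bar>f z * D z - g z * D z\<bar> \<le> e / (?C + 1) * \<bar>D z\<bar>" if "z \<in> space disc_measure" for z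
      proof -
        have "z \<in> cball 0 1" using that by (simp add: unit_disc_eq_ball)
        have "\<bar>f z * D z - g z * D z\<bar> = \<bar>f z - g z\<bar> * \<bar>D z\<bar>" by (simp add: abs_mult flip: left_diff_distrib)
        also have "\<dots> \<le> e / (?C + 1) * \<bar>D z\<bar>"
          using g(2)[OF \<open>z \<in> cball 0 1\<close>] by (intro mult_right_mono) auto
        finally show ?thesis .
      qed
    qed (use i Di in auto)
    also have "\<dots> = e * (?C / (?C + 1))" by simp
    also have "\<dots> \<le> e * 1"
    proof -
      have "?C \<ge> 0" by simp
      then have "?C / (?C + 1) \<le> 1" by (simp add: add_nonneg_pos)
      then show ?thesis using \<open>e > 0\<close> by (intro mult_left_mono) auto
    qed
    finally show ?thesis by simp
  qed
  then have "\<bar>\<integral>z. f z * D z \<partial>disc_measure\<bar> \<le> 0" by (rule dense_ge)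
  then show ?thesis by simp
qed

text \<open>By measurability \<open>sgn D\<close>, extended by zero, is an almost everywhere limit
  of continuous functions; dominated convergence with bound \<open>\<bar>D\<bar>\<close> then makes
  the \<open>L\<^sup>1\<close> norm of \<open>D\<close> vanish.\<close>

lemma orthogonal_continuous_imp_AE_zero:
  assumes D: "L2_fun disc_measure D"
    and orth: "\<And>f. continuous_on UNIV f \<Longrightarrow> (\<integral>z. f z * D z \<partial>disc_measure) = 0"
  shows "AE z in disc_measure. D z = 0"
proof -
  have Dm [measurable]: "D \<in> borel_measurable disc_measure" using D by (simp add: L2_fun_def)
  have Di: "integrable disc_measure (\<lambda>z. \<bar>D z\<bar>)"
    using L2_fun_disc_integrable[OF D] by simp
  have "(\<lambda>z. sgn (D z)) \<in> borel_measurable disc_measure" by measurable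
  then have "(\<lambda>z. if z \<in> unit_disc then sgn (D z) else 0) \<in> borel_measurable lebesgue"
    by (subst (asm) borel_measurable_if[symmetric]) auto
  then have "(\<lambda>z. if z \<in> unit_disc then sgn (D z) else 0) measurable_on UNIV"
    by (rule lebesgue_measurable_imp_measurable_on_real) simp
  then obtain N g where N: "negligible N" and gc: "\<And>n. continuous_on UNIV (g n)"
    and lim: "\<And>z. z \<notin> N \<Longrightarrow> (\<lambda>n. g n z) \<longlonglongrightarrow> (if z \<in> unit_disc then sgn (D z) else 0)"
    unfolding measurable_on_def by auto
  \<comment> \<open>Truncated continuous approximations of \<open>sgn D\<close> test \<open>D\<close> against its own sign.\<close>
  define h where "h n z = max (-1) (min 1 (g n z))" for n z
  have hc: "continuous_on UNIV (h n)" for n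
    unfolding h_def by (intro continuous_intros gc)
  have "AE z in lebesgue. z \<notin> N"
    using N by (intro AE_not_in) (simp add: negligible_iff_null_sets)
  then have ae: "AE z in disc_measure. z \<notin> N"
    by (subst AE_restrict_space_iff) auto
  have "(\<lambda>n. \<integral>z. h n z * D z \<partial>disc_measure) \<longlonglongrightarrow> (\<integral>z. \<bar>D z\<bar> \<partial>disc_measure)"
  proof (rule integral_dominated_convergence[OF _ _ Di])
    show "AE z in disc_measure. (\<lambda>n. h n z * D z) \<longlonglongrightarrow> \<bar>D z\<bar>"
      using ae AE_space
    proof eventually_elim
      case (elim z)
      then have "(\<lambda>n. g n z) \<longlonglongrightarrow> sgn (D z)" using lim[of z] by simp
      then have "(\<lambda>n. h n z * D z) \<longlonglongrightarrow> max (-1) (min 1 (sgn (D z))) * D z"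
        unfolding h_def by (intro tendsto_intros)
      also have "max (-1) (min 1 (sgn (D z))) * D z = \<bar>D z\<bar>"
        by (auto simp: sgn_if)
      finally show ?case .
    qed
    show "AE z in disc_measure. norm (h n z * D z) \<le> \<bar>D z\<bar>" for n
    proof (rule AE_I2)
      fix z
      have "\<bar>h n z\<bar> \<le> 1" by (simp add: h_def)
      then show "norm (h n z * D z) \<le> \<bar>D z\<bar>"
        using mult_right_mono[of "\<bar>h n z\<bar>" 1 "\<bar>D z\<bar>"] by (simp add: abs_mult)
    qed
    show "(\<lambda>z. h n z * D z) \<in> borel_measurable disc_measure" for n
      using L2_fun_mult_integrable[OF L2_fun_continuous[OF hc] D] by (rule borel_measurable_integrable)
  qed measurable
  then have "(\<integral>z. \<bar>D z\<bar> \<partial>disc_measure) = 0"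
    using orth[OF hc] by (simp add: LIMSEQ_const_iff)
  then show ?thesis
    using integral_nonneg_eq_0_iff_AE[OF Di] by simp
qed

lemma zernike_complete:
  assumes "L2_fun disc_measure D"
    and "\<And>k n. (\<integral>z. Re (zernike k n z) * D z \<partial>disc_measure) = 0"
    and "\<And>k n. (\<integral>z. Im (zernike k n z) * D z \<partial>disc_measure) = 0"
  shows "AE z in disc_measure. D z = 0"
  using orthogonal_continuous_imp_AE_zero[OF assms(1) orthogonal_polynomial_imp_orthogonal_continuous[OF assms(1)
      orthogonal_zernike_imp_orthogonal_polynomial[OF assms]]] .


section \<open>The reconstruction formula\<close>

lemma K_cc_eq: "K_cc \<gamma> = (\<lambda>i j. lin_DN \<gamma> (\<lambda>\<phi>. Re (1 * cis (real i * \<phi>))) (\<lambda>\<phi>. Re (1 * cis (real j * \<phi>))))"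
  by (intro ext) (simp add: K_cc_def)

lemma K_cs_eq: "K_cs \<gamma> = (\<lambda>i j. lin_DN \<gamma> (\<lambda>\<phi>. Re (1 * cis (real i * \<phi>))) (\<lambda>\<phi>. Re (- \<i> * cis (real j * \<phi>))))"
  by (intro ext) (simp add: K_cs_def)

text \<open>Serves the cosine series with \<open>d = 1\<close> and the sine series with
  \<open>d = - \<i>\<close>. The shift to \<open>Suc k\<close> avoids angular index 0, where the
  norms are different.\<close>

lemma zernike_expansion:
  assumes \<gamma>: "L2_fun disc_measure \<gamma>" and d: "Re (d * cnj d) = 1"
    and "a = (\<lambda>k n. recon_coeff (\<lambda>i j. lin_DN \<gamma> (\<lambda>\<phi>. Re (1 * cis (real i * \<phi>))) (\<lambda>\<phi>. Re (d * cis (real j * \<phi>)))) n (Suc k))"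
  shows "\<exists>S s. (\<forall>k. L2_sums disc_measure (\<lambda>n z. Re (d * zernike (Suc k) n z) * a k n) (S k)) \<and>
    L2_sums disc_measure S s \<and>
    (\<forall>k n. (\<integral>z. s z * Re (d * zernike (Suc k) n z) \<partial>disc_measure) = (\<integral>z. Re (d * zernike (Suc k) n z) * \<gamma> z \<partial>disc_measure)) \<and>
    (\<forall>h. L2_fun disc_measure h \<longrightarrow> (\<forall>k n. (\<integral>z. Re (d * zernike (Suc k) n z) * h z \<partial>disc_measure) = 0) \<longrightarrow>
      (\<integral>z. s z * h z \<partial>disc_measure) = 0)"
proof (rule orthogonal_expansion_iterated[where e = "\<lambda>k n z. Re (d * zernike (Suc k) n z)"])
  show "(\<integral>z. Re (d * zernike (Suc j) m z) * Re (d * zernike (Suc k) n z) \<partial>disc_measure) = 0"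
    if "(j, m) \<noteq> (k, n)" for j k m n
    using that by (simp only: integral_Re_zernike_mult) auto
  show "a k n * (\<integral>z. (Re (d * zernike (Suc k) n z))\<^sup>2 \<partial>disc_measure) =
    (\<integral>z. Re (d * zernike (Suc k) n z) * \<gamma> z \<partial>disc_measure)" for k n
    unfolding assms(3) zernike_projection[OF \<gamma>] d by simp
qed (fact \<gamma> L2_fun_Re_zernike)+

theorem theorem1:
  fixes \<gamma> :: "real \<times> real \<Rightarrow> real"
    and p q :: "nat \<Rightarrow> nat \<Rightarrow> real"
  defines "p \<equiv> recon_coeff (K_cc \<gamma>)"
    and "q \<equiv> recon_coeff (K_cs \<gamma>)"
  assumes "L2_fun (lebesgue_on unit_disc) \<gamma>"
  shows "\<exists>A C S Ck Sk.
      L2_sums (lebesgue_on unit_disc)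
        (\<lambda>n z. radial_poly 0 n (polar_radius z) * p n 0) A \<and>
      (\<forall>k\<ge>1. L2_sums (lebesgue_on unit_disc)
        (\<lambda>n z. radial_poly k n (polar_radius z) * cos (real k * polar_angle z) * p n k) (Ck k)) \<and>
      (\<forall>k\<ge>1. L2_sums (lebesgue_on unit_disc)
        (\<lambda>n z. radial_poly k n (polar_radius z) * sin (real k * polar_angle z) * q n k) (Sk k)) \<and>
      L2_sums (lebesgue_on unit_disc) (\<lambda>k. Ck (Suc k)) C \<and>
      L2_sums (lebesgue_on unit_disc) (\<lambda>k. Sk (Suc k)) S \<and>
      (AE z in lebesgue_on unit_disc. \<gamma> z = 1 / 2 * A z + C z + S z)"
proof -
  note \<gamma> = assms(3)
  let ?c = "\<lambda>k n z. Re (1 * zernike k n z)" and ?s = "\<lambda>k n z. Re (- \<i> * zernike k n z)"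
  have c: "?c k n z = radial_poly k n (polar_radius z) * cos (real k * polar_angle z)"
    and s: "?s k n z = radial_poly k n (polar_radius z) * sin (real k * polar_angle z)" for k n z
    by (simp_all add: zernike_polar)
  note L = L2_fun_Re_zernike
  have cs: "(\<integral>z. ?c j m z * ?s k n z \<partial>disc_measure) = 0" "(\<integral>z. ?s j m z * ?c k n z \<partial>disc_measure) = 0" for j k m n
    by (simp_all only: integral_Re_zernike_mult) auto
  have cc: "(\<integral>z. ?c j m z * ?c k n z \<partial>disc_measure) = 0" if "(j, m) \<noteq> (k, n)" for j k m n
    using that by (simp only: integral_Re_zernike_mult) auto

  \<comment> \<open>For \<open>k = 0\<close> the coefficients \<open>p n 0\<close> are the Fourier
    coefficients of \<open>2 * \<gamma>\<close>, so \<open>A\<close> is twice the radial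
    part.\<close>
  have "\<exists>A. L2_sums disc_measure (\<lambda>n z. ?c 0 n z * p n 0) A \<and>
    (\<integral>z. A z * (2 * \<gamma> z) \<partial>disc_measure) = (\<integral>z. (A z)\<^sup>2 \<partial>disc_measure) \<and>
    (\<forall>n. (\<integral>z. A z * ?c 0 n z \<partial>disc_measure) = (\<integral>z. ?c 0 n z * (2 * \<gamma> z) \<partial>disc_measure)) \<and>
    (\<forall>h. L2_fun disc_measure h \<longrightarrow> (\<forall>n. (\<integral>z. ?c 0 n z * h z \<partial>disc_measure) = 0) \<longrightarrow> (\<integral>z. A z * h z \<partial>disc_measure) = 0)"
  proof (rule orthogonal_expansion)
    show "L2_fun disc_measure (\<lambda>z. 2 * \<gamma> z)" by (rule L2_fun_cmult[OF \<gamma>])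
    show "(\<integral>z. ?c 0 m z * ?c 0 n z \<partial>disc_measure) = 0" if "m \<noteq> n" for m n
      using that by (intro cc) simp
    have "(\<integral>z. ?c 0 n z * (2 * \<gamma> z) \<partial>disc_measure) = 2 * (\<integral>z. ?c 0 n z * \<gamma> z \<partial>disc_measure)" for n
      by (simp only: mult.left_commute integral_mult_right_zero)
    then show "p n 0 * (\<integral>z. (?c 0 n z)\<^sup>2 \<partial>disc_measure) = (\<integral>z. ?c 0 n z * (2 * \<gamma> z) \<partial>disc_measure)" for n
      unfolding p_def K_cc_eq zernike_projection[OF \<gamma>] by simp
  qed (rule L)
  then obtain A where A: "L2_sums disc_measure (\<lambda>n z. ?c 0 n z * p n 0) A"
    and Ac: "\<And>n. (\<integral>z. A z * ?c 0 n z \<partial>disc_measure) = (\<integral>z. ?c 0 n z * (2 * \<gamma> z) \<partial>disc_measure)"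
    and A0: "\<And>h. L2_fun disc_measure h \<Longrightarrow> (\<And>n. (\<integral>z. ?c 0 n z * h z \<partial>disc_measure) = 0) \<Longrightarrow> (\<integral>z. A z * h z \<partial>disc_measure) = 0"
    by blast
  have p: "(\<lambda>k n. p n (Suc k)) = (\<lambda>k n. recon_coeff (\<lambda>i j. lin_DN \<gamma> (\<lambda>\<phi>. Re (1 * cis (real i * \<phi>)))
      (\<lambda>\<phi>. Re (1 * cis (real j * \<phi>)))) n (Suc k))"
    unfolding p_def K_cc_eq ..
  have q: "(\<lambda>k n. q n (Suc k)) = (\<lambda>k n. recon_coeff (\<lambda>i j. lin_DN \<gamma> (\<lambda>\<phi>. Re (1 * cis (real i * \<phi>)))
      (\<lambda>\<phi>. Re (- \<i> * cis (real j * \<phi>)))) n (Suc k))"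
    unfolding q_def K_cs_eq ..
  obtain Ck C where Ck: "\<And>k. L2_sums disc_measure (\<lambda>n z. ?c (Suc k) n z * p n (Suc k)) (Ck k)"
    and C: "L2_sums disc_measure Ck C"
    and Cc: "\<And>k n. (\<integral>z. C z * ?c (Suc k) n z \<partial>disc_measure) = (\<integral>z. ?c (Suc k) n z * \<gamma> z \<partial>disc_measure)"
    and C0: "\<And>h. L2_fun disc_measure h \<Longrightarrow> (\<And>k n. (\<integral>z. ?c (Suc k) n z * h z \<partial>disc_measure) = 0) \<Longrightarrow> (\<integral>z. C z * h z \<partial>disc_measure) = 0"
    using zernike_expansion[OF \<gamma> _ p] by auto
  obtain Sk S where Sk: "\<And>k. L2_sums disc_measure (\<lambda>n z. ?s (Suc k) n z * q n (Suc k)) (Sk k)"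
    and S: "L2_sums disc_measure Sk S"
    and Ss: "\<And>k n. (\<integral>z. S z * ?s (Suc k) n z \<partial>disc_measure) = (\<integral>z. ?s (Suc k) n z * \<gamma> z \<partial>disc_measure)"
    and S0: "\<And>h. L2_fun disc_measure h \<Longrightarrow> (\<And>k n. (\<integral>z. ?s (Suc k) n z * h z \<partial>disc_measure) = 0) \<Longrightarrow> (\<integral>z. S z * h z \<partial>disc_measure) = 0"
    using zernike_expansion[OF \<gamma> _ q] by auto
  have L2: "L2_fun disc_measure A" "L2_fun disc_measure C" "L2_fun disc_measure S"
    using A C S by (auto simp: L2_sums_def)

  \<comment> \<open>The error of the formula is orthogonal to every Zernike polynomial; completeness
    then makes it vanish.\<close>
  define D where "D z = \<gamma> z - 1 / 2 * A z - C z - S z" for z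
  have D: "L2_fun disc_measure D"
    unfolding D_def by (intro L2_fun_diff L2_fun_cmult \<gamma> L2)
  have inner_D: "(\<integral>z. h z * D z \<partial>disc_measure) = (\<integral>z. h z * \<gamma> z \<partial>disc_measure)
      - 1 / 2 * (\<integral>z. A z * h z \<partial>disc_measure) - (\<integral>z. C z * h z \<partial>disc_measure) - (\<integral>z. S z * h z \<partial>disc_measure)"
    if h: "L2_fun disc_measure h" for h
  proof -
    note i = L2_fun_mult_integrable[OF h \<gamma>] L2_fun_mult_integrable[OF L2(1) h]
      L2_fun_mult_integrable[OF L2(2) h] L2_fun_mult_integrable[OF L2(3) h]
    have "h z * D z = h z * \<gamma> z - 1 / 2 * (A z * h z) - C z * h z - S z * h z" for z
      by (simp add: D_def algebra_simps)
    then show ?thesis using i by simp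
  qed
  have "(\<integral>z. ?c k n z * D z \<partial>disc_measure) = 0" for k n
  proof (cases k)
    case 0
    have "(\<integral>z. C z * ?c k n z \<partial>disc_measure) = 0" using 0 by (intro C0 L cc) simp
    moreover have "(\<integral>z. S z * ?c k n z \<partial>disc_measure) = 0" by (intro S0 L cs)
    moreover have "(\<integral>z. A z * ?c k n z \<partial>disc_measure) = 2 * (\<integral>z. ?c k n z * \<gamma> z \<partial>disc_measure)"
      unfolding 0 Ac by (simp only: mult.left_commute integral_mult_right_zero)
    ultimately show ?thesis unfolding inner_D[OF L] by simp
  next
    case (Suc k')
    have "(\<integral>z. A z * ?c k n z \<partial>disc_measure) = 0" using Suc by (intro A0 L cc) simp
    moreover have "(\<integral>z. S z * ?c k n z \<partial>disc_measure) = 0" by (intro S0 L cs)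
    moreover have "(\<integral>z. C z * ?c k n z \<partial>disc_measure) = (\<integral>z. ?c k n z * \<gamma> z \<partial>disc_measure)"
      unfolding Suc by (rule Cc)
    ultimately show ?thesis unfolding inner_D[OF L] by simp
  qed
  then have Dc: "(\<integral>z. Re (zernike k n z) * D z \<partial>disc_measure) = 0" for k n by simp
  have "(\<integral>z. ?s k n z * D z \<partial>disc_measure) = 0" for k n
  proof (cases k)
    case 0
    \<comment> \<open>The imaginary part is zero for \<open>k = 0\<close>, since
      \<open>sin 0 = 0\<close>.\<close>
    have "?s k n z = 0" for z unfolding s 0 by simp
    then show ?thesis by simp
  next
    case (Suc k')
    have "(\<integral>z. A z * ?s k n z \<partial>disc_measure) = 0" by (intro A0 L cs)
    moreover have "(\<integral>z. C z * ?s k n z \<partial>disc_measure) = 0" by (intro C0 L cs)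
    moreover have "(\<integral>z. S z * ?s k n z \<partial>disc_measure) = (\<integral>z. ?s k n z * \<gamma> z \<partial>disc_measure)"
      unfolding Suc by (rule Ss)
    ultimately show ?thesis unfolding inner_D[OF L] by simp
  qed
  then have "(\<integral>z. Im (zernike k n z) * D z \<partial>disc_measure) = 0" for k n by simp
  then have "AE z in disc_measure. D z = 0" by (rule zernike_complete[OF D Dc])
  then have AE: "AE z in disc_measure. \<gamma> z = 1 / 2 * A z + C z + S z"
    by eventually_elim (simp add: D_def)
  \<comment> \<open>The inner sums were obtained with index starting at 0, hence the shift by
    \<open>k - 1\<close>.\<close>
  have Ck': "L2_sums disc_measure
        (\<lambda>n z. radial_poly k n (polar_radius z) * cos (real k * polar_angle z) * p n k) (Ck (k - 1))"
    and Sk': "L2_sums disc_measure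
        (\<lambda>n z. radial_poly k n (polar_radius z) * sin (real k * polar_angle z) * q n k) (Sk (k - 1))"
    if k1: "k \<ge> 1" for k
  proof -
    obtain k' where k: "k = Suc k'" using k1 by (cases k) auto
    show "L2_sums disc_measure
        (\<lambda>n z. radial_poly k n (polar_radius z) * cos (real k * polar_angle z) * p n k) (Ck (k - 1))"
      using Ck[of k'] unfolding c k by (simp only: diff_Suc_1)
    show "L2_sums disc_measure
        (\<lambda>n z. radial_poly k n (polar_radius z) * sin (real k * polar_angle z) * q n k) (Sk (k - 1))"
      using Sk[of k'] unfolding s k by (simp only: diff_Suc_1)
  qed
  show ?thesis
  proof (intro exI conjI)
    show "L2_sums (lebesgue_on unit_disc) (\<lambda>n z. radial_poly 0 n (polar_radius z) * p n 0) A"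
      using A unfolding c by simp
    show "\<forall>k\<ge>1. L2_sums (lebesgue_on unit_disc)
        (\<lambda>n z. radial_poly k n (polar_radius z) * cos (real k * polar_angle z) * p n k) (Ck (k - 1))"
      using Ck' by blast
    show "\<forall>k\<ge>1. L2_sums (lebesgue_on unit_disc)
        (\<lambda>n z. radial_poly k n (polar_radius z) * sin (real k * polar_angle z) * q n k) (Sk (k - 1))"
      using Sk' by blast
    show "L2_sums (lebesgue_on unit_disc) (\<lambda>k. Ck (Suc k - 1)) C" using C by simp
    show "L2_sums (lebesgue_on unit_disc) (\<lambda>k. Sk (Suc k - 1)) S" using S by simp
  qed (rule AE)
qed

end
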